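(* Let $X\sim F$ be a random variable with values in $\mathbb{R}$ having finite moments of all positive integer orders, and let $F$ be absolutely continuous on $\mathbb{R}_{x_0}=\mathbb{R}\setminus(-x_0,x_0)$ for some $x_0>\mathrm{e}$ with density $F'(x)=f(x)>0$ on $\mathbb{R}_{x_0}$. Let $a>0$ and $\alpha\in[0,1]$, and let $\phi$ be any one of the three functions $$\phi_1(x)=a(\log x)^{\alpha},\qquad \phi_2(x)=a(\log x)^{\alpha}+\log\log x,\qquad \phi_3(x)=\frac{a(\log x)^{\alpha}}{\log\log x}\qquad (x>\mathrm{e}).$$ Suppose that $$\limsup_{|x|\to\infty}\frac{f(x+\mathrm{sign}(x)\,\phi(|x|))}{f(x)}<1.$$ Then the moments of $X$ satisfy Carleman's condition $$\sum_{n=1}^{\infty}\left(\mathsf{E}[X^{2n}]\right)^{-1/(2n)}=\infty,$$ and hence $X$ is M-det on $\mathbb{R}$. Moreover, $X^2$ and $|X|$ are also M-det on $\mathbb{R}$ and on $\mathbb{R}_+$.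
   Context: $\mathbb{R}_+=[0,\infty)$. $X\sim F$ means that the random variable $X$ has distribution (function) $F$. $\mathrm{sign}(x)=1$ if $x\ge 0$ and $\mathrm{sign}(x)=-1$ if $x<0$. The distribution $F$ is arbitrary on $(-x_0,x_0)$; only its restriction to $\mathbb{R}_{x_0}$ is assumed absolutely continuous. M-determinacy: a random variable with finite moments of all orders and values in $\mathbb{R}$ is M-det (moment-determinate) on $\mathbb{R}$ if no probability distribution on $\mathbb{R}$ other than its own has the same moment sequence (moments of all orders $n\in\mathbb{N}=\{1,2,\ldots\}$). A random variable with values in $\mathbb{R}_+$ is M-det on $\mathbb{R}_+$ if no probability distribution on $\mathbb{R}_+$ other than its own has the same moment sequence. *)

theory Defs
  imports "HOL-Probability.Probability"
begin

(* Unlike sgn, this takes the value 1 at 0. *)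
definition sign :: "real \<Rightarrow> real" where
  "sign x = (if x \<ge> 0 then 1 else - 1)"

(* The three functions phi are meant for x > e; only their values there matter below. *)
definition phi1 :: "real \<Rightarrow> real \<Rightarrow> real \<Rightarrow> real" where
  "phi1 a \<alpha> x = a * (ln x) powr \<alpha>"

definition phi2 :: "real \<Rightarrow> real \<Rightarrow> real \<Rightarrow> real" where
  "phi2 a \<alpha> x = a * (ln x) powr \<alpha> + ln (ln x)"

definition phi3 :: "real \<Rightarrow> real \<Rightarrow> real \<Rightarrow> real" where
  "phi3 a \<alpha> x = a * (ln x) powr \<alpha> / ln (ln x)"

(* F is absolutely continuous on S with density f: f is a Borel version of the density of
   F restricted to S. Neither F nor f is constrained outside S. *)
definition has_density_on :: "real measure \<Rightarrow> real set \<Rightarrow> (real \<Rightarrow> real) \<Rightarrow> bool" where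
  "has_density_on F S f \<longleftrightarrow>
     f \<in> borel_measurable (restrict_space lborel S) \<and>
     (\<forall>x\<in>S. f x \<ge> 0) \<and>
     restrict_space F S = density (restrict_space lborel S) (\<lambda>x. ennreal (f x))"

(* Probability distributions on a Borel set S are represented as Borel probability measures
   on the real line that give S full mass. *)
definition distribution_on :: "real set \<Rightarrow> real measure \<Rightarrow> bool" where
  "distribution_on S \<mu> \<longleftrightarrow> real_distribution \<mu> \<and> measure \<mu> S = 1"

definition finite_moments :: "real measure \<Rightarrow> bool" where
  "finite_moments \<mu> \<longleftrightarrow> (\<forall>n\<ge>1. integrable \<mu> (\<lambda>x. x ^ n))"

(* Used with S = UNIV (M-det on the real line) and S = {0..} (M-det on the half-line). *)
definition m_det_on :: "real set \<Rightarrow> real measure \<Rightarrow> bool" where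
  "m_det_on S \<mu> \<longleftrightarrow>
     distribution_on S \<mu> \<and> finite_moments \<mu> \<and>
     (\<forall>\<nu>. distribution_on S \<nu> \<and> finite_moments \<nu> \<and>
          (\<forall>n\<ge>1. (\<integral>x. x ^ n \<partial>\<nu>) = (\<integral>x. x ^ n \<partial>\<mu>)) \<longrightarrow> \<nu> = \<mu>)"

end

theory Submission
  imports Defs "HOL-Complex_Analysis.Complex_Analysis" "HOL-Real_Asymp.Real_Asymp"
    "HOL-Computational_Algebra.Fundamental_Theorem_Algebra"
begin

text \<open>
  The hypothesis says that f loses a factor q < 1 each time its argument moves by \<phi>, and \<phi> x is at
  most of the order log x. So f decays roughly like exp (- c x / log x): comparing the integral of
  exp (c x / log x) f over [R, T b], T x = x + \<phi> x, with the one over [R, b] by substitution shows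
  that E exp (c |X| / log |X|) is finite (exp_tail_of_density_ratio). Such a tail gives
  E X^(2n) \<le> (C * r 0 * ... * r (n - 1))^2 with r k = D (k + 1) ln (k + 4)
  (moment_bound_of_exp_tail). As the sum of the 1 / r k diverges, Carleman's condition follows
  (carleman_diverges).

  Determinacy of X and of |X| rests on Bang's proof of the Denjoy-Carleman theorem, carried out for the
  distance to the polynomials in a weighted supremum norm: the exponentials exp (i t x) are limits of
  polynomials (iexp_poly_approx). The weight depends on the moment bounds only, and it is
  integrable for every distribution that obeys them, so the moments determine the characteristic
  function (determinate).

  For X^2 on the whole line Carleman's condition may fail, because its moments are only bounded by
  about (n log n)^(2n). Let \<mu> be the distribution of X^2 and suppose that \<nu> \<noteq> \<mu> has the same moments.
  The Stieltjes transforms of \<mu> and \<nu> differ by a nonzero holomorphic function on the upper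
  half-plane; dividing by it bounds |p w|, for a polynomial p and w in any compact part of a
  horizontal strip around the real line, by the L2 norm of p with respect to \<mu>
  (poly_eval_bound_strip). On the other hand, the approximation theorem above, applied to X, gives
  polynomials q n with q n 0 \<longlonglongrightarrow> 1 that tend in L2 of \<mu> to the indicator of {0}
  (zero_approx_square). By the evaluation bound the q n converge uniformly to a holomorphic function Q
  with Q 0 = 1. But Q vanishes \<mu>-almost everywhere away from 0, and \<mu> has positive mass and no atoms on
  some interval there; so Q has an accumulation point of zeros, a contradiction
  (hamburger_determinate_of_zero_approx).

  Every distribution on the half-line is one on the line, so determinacy on the half-line is inherited.
\<close>

section \<open>Bang's argument in weighted supremum norms\<close>

text \<open>
  The weighted supremum norm needs no measurability or integrability, and one approximant serves all
  measures for which V is square integrable.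
\<close>

definition poly_approx :: "(real \<Rightarrow> real) \<Rightarrow> (real \<Rightarrow> complex) \<Rightarrow> real \<Rightarrow> bool" where
  "poly_approx V u \<eta> \<longleftrightarrow> (\<exists>p :: complex poly. \<forall>x. cmod (u x - poly p (of_real x)) \<le> \<eta> * V x)"

lemma poly_approx_mono:
  assumes "poly_approx V u \<eta>" "\<eta> \<le> \<eta>'" "\<And>x. V x \<ge> 0"
  shows "poly_approx V u \<eta>'"
  using assms unfolding poly_approx_def by (meson mult_right_mono order_trans)

lemma poly_approx_add:
  assumes "poly_approx V u \<eta>" "poly_approx V v \<theta>"
  shows "poly_approx V (\<lambda>x. u x + v x) (\<eta> + \<theta>)"
proof -
  obtain p q where p: "\<And>x. cmod (u x - poly p (of_real x)) \<le> \<eta> * V x"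
    and q: "\<And>x. cmod (v x - poly q (of_real x)) \<le> \<theta> * V x"
    using assms unfolding poly_approx_def by blast
  have "cmod (u x + v x - poly (p + q) (of_real x)) \<le> (\<eta> + \<theta>) * V x" for x
    using norm_triangle_ineq[of "u x - poly p (of_real x)" "v x - poly q (of_real x)"] p[of x] q[of x]
    by (simp add: algebra_simps)
  then show ?thesis unfolding poly_approx_def by blast
qed

lemma poly_approx_cmult:
  assumes "poly_approx V u \<eta>"
  shows "poly_approx V (\<lambda>x. c * u x) (cmod c * \<eta>)"
proof -
  obtain p where p: "\<And>x. cmod (u x - poly p (of_real x)) \<le> \<eta> * V x"
    using assms unfolding poly_approx_def by blast
  have "cmod (c * u x - poly (smult c p) (of_real x)) \<le> cmod c * \<eta> * V x" for x
    using mult_left_mono[OF p[of x], of "cmod c"]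
    by (simp flip: norm_mult add: algebra_simps)
  then show ?thesis unfolding poly_approx_def by blast
qed

lemma poly_approx_sum:
  assumes "finite A" "\<And>k. k \<in> A \<Longrightarrow> poly_approx V (u k) (\<eta> k)"
  shows "poly_approx V (\<lambda>x. \<Sum>k\<in>A. u k x) (\<Sum>k\<in>A. \<eta> k)"
  using assms
proof (induction A rule: finite_induct)
  case empty
  show ?case unfolding poly_approx_def by (rule exI[of _ 0]) simp
next
  case (insert a A)
  then show ?case by (simp add: poly_approx_add)
qed

lemma poly_approx_perturb:
  assumes "poly_approx V u \<eta>" "\<And>x. cmod (w x - u x) \<le> \<theta> * V x"
  shows "poly_approx V w (\<eta> + \<theta>)"
proof -
  have "poly_approx V (\<lambda>x. w x - u x) \<theta>"
    unfolding poly_approx_def by (rule exI[of _ 0]) (use assms in simp)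
  from poly_approx_add[OF assms(1) this] show ?thesis by simp
qed

lemma sum_power_div_fact_le_exp:
  fixes z :: real
  assumes "z \<ge> 0" "finite A"
  shows "(\<Sum>k\<in>A. z ^ k / fact k) \<le> exp z"
proof -
  have "(\<Sum>k\<in>A. z ^ k / fact k) \<le> (\<Sum>k. z ^ k / fact k)"
    using assms summable_exp_generic[of z] by (intro sum_le_suminf) (auto simp: field_simps scaleR_conv_of_real)
  then show ?thesis by (simp add: exp_def scaleR_conv_of_real field_simps)
qed

text \<open>
  The numbers C * r 0 * ... * r (n - 1) form a logarithmically convex sequence since r is increasing;
  non-summability of 1 / r is the Denjoy-Carleman condition for this sequence.
\<close>

locale moment_weight =
  fixes V :: "real \<Rightarrow> real" and C :: real and r :: "nat \<Rightarrow> real"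
  assumes C_pos: "C > 0" and r_pos: "\<And>k. r k > 0" and r_mono: "mono r"
    and not_summable_r: "\<not> summable (\<lambda>k. 1 / r k)"
    and power_le: "\<And>n x. \<bar>x\<bar> ^ n \<le> C * (\<Prod>k<n. r k) * V x"
begin

definition majorant :: "nat \<Rightarrow> real" where "majorant n = C * (\<Prod>k<n. r k)"

lemma majorant_pos: "majorant n > 0"
  unfolding majorant_def using C_pos r_pos by (simp add: prod_pos)

lemma V_pos: "V x > 0"
  using power_le[where n = 0 and x = x] C_pos by simp (smt (verit) zero_less_mult_pos)

lemma V_nonneg: "V x \<ge> 0"
  using V_pos[of x] by simp

lemma majorant_add_le:
  assumes "n + k \<le> N"
  shows "majorant (n + k) \<le> majorant n * r (N - 1) ^ k"
  using assms
proof (induction k)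
  case (Suc k)
  have "majorant (n + Suc k) = majorant (n + k) * r (n + k)" by (simp add: majorant_def)
  also have "\<dots> \<le> (majorant n * r (N - 1) ^ k) * r (N - 1)"
    using Suc r_pos[of "n + k"] majorant_pos[of n] r_pos[of "N - 1"]
    by (intro mult_mono Suc.IH monoD[OF r_mono]) (auto intro!: mult_nonneg_nonneg less_imp_le)
  finally show ?case by (simp add: mult_ac)
qed auto

text \<open>
  Relative to the scale e^n * majorant n, the distances of all the functions x^n exp (i t x) to the
  polynomials are at most e^(-K). These functions are, up to powers of i, the derivatives of
  t \<mapsto> exp (i t x), so this is the quantity that Bang follows along the t-axis.
\<close>

definition Bang_bound :: "real \<Rightarrow> nat \<Rightarrow> bool" where
  "Bang_bound t K \<longleftrightarrow> (\<forall>n. poly_approx V (\<lambda>x. of_real x ^ n * iexp (t * x)) (exp (real n - real K) * majorant n))"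

text \<open>
  The weight dominates x^n, so for n \<ge> K the zero polynomial is good enough; only finitely many n
  matter at each level K.
\<close>

lemma poly_approx_trivial:
  assumes "n \<ge> K"
  shows "poly_approx V (\<lambda>x. of_real x ^ n * iexp (t * x)) (exp (real n - real K) * majorant n)"
proof -
  have "\<bar>x\<bar> ^ n \<le> exp (real n - real K) * majorant n * V x" for x
  proof -
    have "\<bar>x\<bar> ^ n \<le> 1 * (majorant n * V x)" using power_le[of x n] by (simp add: majorant_def)
    also have "\<dots> \<le> exp (real n - real K) * (majorant n * V x)"
      using assms majorant_pos[of n] V_pos[of x] by (intro mult_right_mono) auto
    finally show ?thesis by (simp add: mult_ac)
  qed
  then show ?thesis unfolding poly_approx_def
    by (intro exI[of _ 0]) (auto simp: norm_mult norm_power)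
qed

lemma Bang_bound_0: "Bang_bound 0 K"
proof -
  have "poly_approx V (\<lambda>x. of_real x ^ n * iexp (0 * x)) 0" for n
    unfolding poly_approx_def by (intro exI[of _ "monom 1 n"]) (simp add: poly_monom)
  then show ?thesis unfolding Bang_bound_def
    using poly_approx_mono V_nonneg majorant_pos by (meson exp_ge_zero less_imp_le mult_nonneg_nonneg)
qed

text \<open>
  Expand exp (i h x) to the order Suc K - n. The Taylor terms are approximable by hypothesis, and the
  remainder is at most a multiple of |x|^(Suc K), which the weight dominates. Logarithmic convexity
  turns all coefficients into terms of the exponential series at s = e |h| r K \<le> 1, so that the bound
  deteriorates by a factor of at most e: one level is lost for a shift of size 1 / (e r K).
\<close>

lemma Bang_step:
  assumes B: "Bang_bound t (Suc K)" and h: "\<bar>h\<bar> \<le> exp (-1) / r K"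
  shows "Bang_bound (t + h) K"
  unfolding Bang_bound_def
proof
  fix n
  show "poly_approx V (\<lambda>x. of_real x ^ n * iexp ((t + h) * x)) (exp (real n - real K) * majorant n)"
  proof (cases "n \<ge> K")
    case True
    then show ?thesis by (rule poly_approx_trivial)
  next
    case False
    define m where "m = K - n"
    have nm: "n + Suc m = Suc K" using False by (simp add: m_def)
    define \<eta> where "\<eta> k = cmod ((\<i> * h) ^ k / fact k) * (exp (real (n + k) - real (Suc K)) * majorant (n + k))" for k
    define u where "u x = (\<Sum>k\<le>m. ((\<i> * h) ^ k / fact k) * (complex_of_real x ^ (n + k) * iexp (t * x)))" for x
    have u: "poly_approx V u (\<Sum>k\<le>m. \<eta> k)"
      unfolding u_def \<eta>_def
      by (intro poly_approx_sum poly_approx_cmult finite_atMost B[unfolded Bang_bound_def, rule_format])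
    \<comment> \<open>The bound for the Taylor remainder, relative to the weight.\<close>
    define \<theta> where "\<theta> = \<bar>h\<bar> ^ Suc m / fact (Suc m) * majorant (Suc K)"
    have rem: "cmod (of_real x ^ n * iexp ((t + h) * x) - u x) \<le> \<theta> * V x" for x
    proof -
      have "of_real x ^ n * iexp ((t + h) * x) - u x
          = of_real x ^ n * iexp (t * x) * (iexp (h * x) - (\<Sum>k\<le>m. (\<i> * of_real (h * x)) ^ k / fact k))"
        by (simp add: u_def sum_distrib_left right_diff_distrib power_mult_distrib power_add
            exp_add[symmetric] algebra_simps)
      also have "cmod \<dots> = \<bar>x\<bar> ^ n * cmod (iexp (h * x) - (\<Sum>k\<le>m. (\<i> * of_real (h * x)) ^ k / fact k))"
        by (simp add: norm_mult norm_power)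
      also have "\<dots> \<le> \<bar>x\<bar> ^ n * (\<bar>h * x\<bar> ^ Suc m / fact (Suc m))"
        by (intro mult_left_mono iexp_approx1) auto
      also have "\<dots> = \<bar>h\<bar> ^ Suc m / fact (Suc m) * \<bar>x\<bar> ^ Suc K"
        by (simp add: nm[symmetric] abs_mult power_mult_distrib power_add field_simps)
      also have "\<dots> \<le> \<bar>h\<bar> ^ Suc m / fact (Suc m) * (majorant (Suc K) * V x)"
        using power_le[of x "Suc K"] unfolding majorant_def by (intro mult_left_mono) auto
      finally show ?thesis by (simp add: \<theta>_def)
    qed
    have main: "poly_approx V (\<lambda>x. of_real x ^ n * iexp ((t + h) * x)) ((\<Sum>k\<le>m. \<eta> k) + \<theta>)"
      by (rule poly_approx_perturb[OF u rem])
    define s where "s = exp 1 * \<bar>h\<bar> * r K"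
    have s: "0 \<le> s" "s \<le> 1"
      using h r_pos[of K] by (auto simp: s_def field_simps exp_minus)
    define E where "E = exp (real n - real (Suc K)) * majorant n"
    have E0: "E \<ge> 0" using majorant_pos[of n] by (simp add: E_def)
    have ek: "\<bar>h\<bar> ^ k / fact k * (exp (real (n + k) - real (Suc K)) * majorant (n + k)) \<le> E * (s ^ k / fact k)"
      if "k \<le> Suc m" for k
    proof -
      have "majorant (n + k) \<le> majorant n * r K ^ k" using majorant_add_le[of n k "Suc K"] that nm by simp
      then have "\<bar>h\<bar> ^ k / fact k * (exp (real (n + k) - real (Suc K)) * majorant (n + k))
        \<le> \<bar>h\<bar> ^ k / fact k * (exp (real (n + k) - real (Suc K)) * (majorant n * r K ^ k))"
        by (intro mult_left_mono) auto
      also have "\<dots> = E * (s ^ k / fact k)"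
      proof -
        have "exp (real (n + k) - real (Suc K)) = exp (real n - real (Suc K)) * exp 1 ^ k"
          by (simp add: exp_of_nat_mult[symmetric] exp_add[symmetric])
        then show ?thesis unfolding E_def s_def by (simp add: power_mult_distrib mult_ac)
      qed
      finally show ?thesis .
    qed
    have "(\<Sum>k\<le>m. \<eta> k) + \<theta> \<le> (\<Sum>k\<le>m. E * (s ^ k / fact k)) + E * (s ^ Suc m / fact (Suc m))"
    proof (intro add_mono sum_mono)
      fix k assume "k \<in> {..m}"
      then show "\<eta> k \<le> E * (s ^ k / fact k)"
        using ek[of k] by (simp add: \<eta>_def norm_mult norm_divide norm_power)
    next
      have "exp (real (n + Suc m) - real (Suc K)) = 1" by (subst nm) simp
      then show "\<theta> \<le> E * (s ^ Suc m / fact (Suc m))"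
        using ek[of "Suc m"] unfolding nm \<theta>_def by simp
    qed
    also have "\<dots> = E * (\<Sum>k\<le>Suc m. s ^ k / fact k)"
      by (simp add: sum_distrib_left distrib_left)
    also have "\<dots> \<le> E * exp s"
      using s by (intro mult_left_mono E0 sum_power_div_fact_le_exp) auto
    also have "\<dots> \<le> E * exp 1" using s E0 by (intro mult_left_mono) auto
    also have "\<dots> = exp (real n - real K) * majorant n"
      by (simp add: E_def exp_add[symmetric] mult_ac)
    finally show ?thesis using poly_approx_mono[OF main] V_nonneg by blast
  qed
qed

text \<open>
  All bounds hold at t = 0, where the functions are polynomials. Moving away from there through the
  levels K + j, ..., K + 1 covers a distance equal to the sum of the admissible steps.
\<close>

lemma Bang_iterate:
  assumes "\<bar>t\<bar> \<le> (\<Sum>k=K..<K+j. exp (-1) / r k)"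
  shows "Bang_bound t K"
  using assms
proof (induction j arbitrary: t K)
  case 0
  then show ?case using Bang_bound_0 by simp
next
  case (Suc j)
  define d where "d = exp (-1) / r K"
  have d: "d > 0" using r_pos[of K] by (simp add: d_def)
  \<comment> \<open>Move towards 0 by at most d, without overshooting.\<close>
  define h where "h = max (-d) (min d t)"
  have h: "\<bar>h\<bar> \<le> d" using d by (auto simp: h_def)
  have "(\<Sum>k=K..<K+Suc j. exp (-1) / r k) = d + (\<Sum>k=Suc K..<Suc K+j. exp (-1) / r k)"
    by (subst sum.atLeast_Suc_lessThan) (auto simp: d_def)
  moreover have "\<bar>t - h\<bar> \<le> max 0 (\<bar>t\<bar> - d)" using d by (auto simp: h_def)
  moreover have "0 \<le> (\<Sum>k=Suc K..<Suc K+j. exp (-1) / r k)"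
    using r_pos by (intro sum_nonneg) (simp add: less_imp_le)
  ultimately have "\<bar>t - h\<bar> \<le> (\<Sum>k=Suc K..<Suc K+j. exp (-1) / r k)"
    using Suc.prems by linarith
  from Suc.IH[OF this] have "Bang_bound (t - h) (Suc K)" .
  from Bang_step[OF this, of h] h show ?case by (simp add: d_def)
qed

text \<open>
  As the steps 1 / (e r k) have infinite sum, every t is reachable from a high enough level while
  ending at an arbitrarily large level K.
\<close>

theorem iexp_poly_approx:
  assumes "\<epsilon> > 0"
  shows "poly_approx V (\<lambda>x. iexp (t * x)) \<epsilon>"
proof -
  obtain K :: nat where K: "exp (- real K) * majorant 0 \<le> \<epsilon>"
  proof -
    have "(\<lambda>K. exp (- real K)) \<longlonglongrightarrow> 0" by real_asymp
    then have "(\<lambda>K. exp (- real K) * majorant 0) \<longlonglongrightarrow> 0" by (rule tendsto_mult_left_zero)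
    then have "\<forall>\<^sub>F K in sequentially. exp (- real K) * majorant 0 < \<epsilon>"
      using assms by (rule order_tendstoD)
    then show ?thesis using that by (auto simp: eventually_sequentially intro: less_imp_le)
  qed
  \<comment> \<open>The steps that remain above level K still have infinite sum.\<close>
  have ns: "\<not> summable (\<lambda>k. exp (-1) / r (k + K))"
  proof
    assume "summable (\<lambda>k. exp (-1) / r (k + K))"
    then have "summable (\<lambda>k. exp 1 * (exp (-1) / r (k + K)))" by (rule summable_mult)
    then have "summable (\<lambda>k. 1 / r (k + K))" by (simp add: exp_minus)
    then show False using not_summable_r summable_iff_shift[of "\<lambda>k. 1 / r k" K] by simp
  qed
  have "\<exists>j. \<bar>t\<bar> \<le> (\<Sum>k<j. exp (-1) / r (k + K))"
  proof (rule ccontr)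
    assume "\<not> ?thesis"
    then have "\<And>j. (\<Sum>k<j. exp (-1) / r (k + K)) \<le> \<bar>t\<bar>" by (meson linear)
    then have "\<And>n. (\<Sum>k\<le>n. exp (-1) / r (k + K)) \<le> \<bar>t\<bar>"
      by (metis lessThan_Suc_atMost)
    then have "summable (\<lambda>k. exp (-1) / r (k + K))"
      using r_pos by (intro bounded_imp_summable[where B = "\<bar>t\<bar>"]) (auto simp: less_imp_le)
    with ns show False by simp
  qed
  then obtain j where j: "\<bar>t\<bar> \<le> (\<Sum>k<j. exp (-1) / r (k + K))" by blast
  also have "(\<Sum>k<j. exp (-1) / r (k + K)) = (\<Sum>k=K..<K+j. exp (-1) / r k)"
    by (rule sum.reindex_bij_witness[of _ "\<lambda>k. k - K" "\<lambda>k. k + K"]) auto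
  finally have "Bang_bound t K" by (rule Bang_iterate)
  then have "poly_approx V (\<lambda>x. of_real x ^ 0 * iexp (t * x)) (exp (real 0 - real K) * majorant 0)"
    unfolding Bang_bound_def by blast
  then show ?thesis using poly_approx_mono[OF _ K] V_nonneg by simp
qed

end

section \<open>Weights built from moment bounds, and determinacy\<close>

text \<open>
  The requirement that r tends to infinity makes the power series W below converge everywhere.
\<close>

locale carleman_sequence =
  fixes C :: real and r :: "nat \<Rightarrow> real"
  assumes C_pos: "C > 0" and r_pos: "\<And>k. r k > 0" and r_mono: "mono r"
    and r_at_top: "filterlim r at_top sequentially"
    and not_summable_r: "\<not> summable (\<lambda>k. 1 / r k)"
begin

definition M :: "nat \<Rightarrow> real" where "M n = C * (\<Prod>k<n. r k)"

lemma M_pos: "M n > 0"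
  unfolding M_def using C_pos r_pos by (simp add: prod_pos)

text \<open>
  The square of the weight. The factor 1 / 2 makes the integrals of the terms summable as soon as the
  integral of x^(2n) is at most (M n)^2; at the same time each single term bounds |x|^n, up to 2^n,
  by M n * sqrt (W x). That W depends on x^2 only will allow the even part of a polynomial to be taken.
\<close>

definition W :: "real \<Rightarrow> real" where "W x = (\<Sum>n. ((x / 2) ^ n / M n)\<^sup>2)"

lemma summable_W: "summable (\<lambda>n. ((x / 2) ^ n / M n)\<^sup>2)"
proof -
  obtain N where N: "\<And>n. n \<ge> N \<Longrightarrow> r n \<ge> \<bar>x\<bar>"
    using r_at_top by (auto simp: filterlim_at_top eventually_sequentially)
  show ?thesis
  proof (rule summable_ratio_test[where c = "1/4" and N = N])
    fix n assume "n \<ge> N"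
    then have "\<bar>x\<bar> / r n \<le> 1" using N r_pos[of n] by simp
    then have *: "(x / r n)\<^sup>2 \<le> 1"
      using r_pos[of n] by (simp add: abs_square_le_1)
    have "((x / 2) ^ Suc n / M (Suc n))\<^sup>2 = 1 / 4 * (x / r n)\<^sup>2 * ((x / 2) ^ n / M n)\<^sup>2"
    proof -
      have "(x / 2) ^ Suc n / M (Suc n) = 1 / 2 * (x / r n) * ((x / 2) ^ n / M n)" by (simp add: M_def)
      then show ?thesis by (simp only: power_mult_distrib) (simp add: power_divide)
    qed
    also have "\<dots> \<le> 1 / 4 * 1 * ((x / 2) ^ n / M n)\<^sup>2"
      using * by (intro mult_right_mono mult_left_mono) auto
    finally show "norm (((x / 2) ^ Suc n / M (Suc n))\<^sup>2) \<le> 1 / 4 * norm (((x / 2) ^ n / M n)\<^sup>2)"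
      by simp
  qed simp
qed

lemma W_nonneg: "W x \<ge> 0"
  unfolding W_def by (intro suminf_nonneg summable_W) simp

lemma W_term: "((x / 2) ^ n / M n)\<^sup>2 = (1 / (4 ^ n * (M n)\<^sup>2)) * x ^ (2 * n)"
proof -
  have "((x / 2) ^ n)\<^sup>2 = ((x / 2)\<^sup>2) ^ n" by (metis mult.commute power_mult)
  then show ?thesis
    by (simp add: power_divide power_mult power_mult_distrib) (simp add: power2_eq_square flip: power_mult_distrib)
qed

lemma W_minus: "W (- x) = W x"
  unfolding W_def W_term by simp

sublocale weight: moment_weight "\<lambda>x. sqrt (W x)" C "\<lambda>k. 2 * r k"
proof
  show "C > 0" "\<And>k. 2 * r k > 0" using C_pos r_pos by auto
  show "mono (\<lambda>k. 2 * r k)" using r_mono by (auto simp: mono_def)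
  show "\<not> summable (\<lambda>k. 1 / (2 * r k))"
    using not_summable_r summable_mult[of "\<lambda>k. 1 / (2 * r k)" 2] by auto
  fix n x
  have "((x / 2) ^ n / M n)\<^sup>2 \<le> W x"
    using sum_le_suminf[OF summable_W, of "{n}" x] by (simp add: W_def)
  then have "\<bar>(x / 2) ^ n / M n\<bar> \<le> sqrt (W x)" by (intro real_le_rsqrt) (simp only: power2_abs)
  moreover have "\<bar>(x / 2) ^ n / M n\<bar> = \<bar>x\<bar> ^ n / (2 ^ n * M n)"
    using M_pos[of n] by (simp add: power_abs abs_divide power_divide)
  ultimately have "\<bar>x\<bar> ^ n \<le> 2 ^ n * M n * sqrt (W x)"
    using M_pos[of n] by (simp add: field_simps)
  then show "\<bar>x\<bar> ^ n \<le> C * (\<Prod>k<n. 2 * r k) * sqrt (W x)"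
    by (simp add: M_def prod.distrib mult_ac)
qed

lemma integrable_W:
  assumes "real_distribution \<mu>" "finite_moments \<mu>" "\<And>n. (\<integral>x. x ^ (2 * n) \<partial>\<mu>) \<le> (M n)\<^sup>2"
  shows "integrable \<mu> W"
proof -
  interpret real_distribution \<mu> by fact
  have int: "integrable \<mu> (\<lambda>x. x ^ n)" for n
    using assms(2) by (cases "n = 0") (auto simp: finite_moments_def)
  show ?thesis unfolding W_def
  proof (rule integrable_suminf)
    show "integrable \<mu> (\<lambda>x. ((x / 2) ^ n / M n)\<^sup>2)" for n
      unfolding W_term by (intro integrable_mult_right int)
    show "AE x in \<mu>. summable (\<lambda>n. norm (((x / 2) ^ n / M n)\<^sup>2))"
      using summable_W by simp
    have b: "(\<integral>x. norm (((x / 2) ^ n / M n)\<^sup>2) \<partial>\<mu>) \<le> (1 / 4) ^ n" for n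
    proof -
      have "(\<integral>x. norm (((x / 2) ^ n / M n)\<^sup>2) \<partial>\<mu>) = (\<integral>x. ((x / 2) ^ n / M n)\<^sup>2 \<partial>\<mu>)" by simp
      also have "\<dots> = (1 / (4 ^ n * (M n)\<^sup>2)) * (\<integral>x. x ^ (2 * n) \<partial>\<mu>)"
        unfolding W_term by simp
      also have "\<dots> \<le> (1 / (4 ^ n * (M n)\<^sup>2)) * (M n)\<^sup>2"
        using assms(3) M_pos[of n] by (intro mult_left_mono) auto
      finally show ?thesis using M_pos[of n] by (simp add: power_divide)
    qed
    show "summable (\<lambda>n. (\<integral>x. norm (((x / 2) ^ n / M n)\<^sup>2) \<partial>\<mu>))"
      by (rule summable_comparison_test[OF _ summable_geometric[of "1/4 :: real"]])
         (use b in auto)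
  qed
qed

end

lemma integrable_poly:
  assumes "real_distribution \<mu>" "finite_moments \<mu>"
  shows "integrable \<mu> (\<lambda>x. poly p (complex_of_real x))"
    and "(\<integral>x. poly p (complex_of_real x) \<partial>\<mu>) = (\<Sum>i\<le>degree p. coeff p i * of_real (\<integral>x. x ^ i \<partial>\<mu>))"
proof -
  interpret real_distribution \<mu> by fact
  have "integrable \<mu> (\<lambda>x. x ^ n)" for n
    using assms(2) by (cases "n = 0") (auto simp: finite_moments_def)
  then have int: "integrable \<mu> (\<lambda>x. coeff p i * complex_of_real (x ^ i))" for i
    by (intro integrable_mult_right integrable_of_real)
  show "integrable \<mu> (\<lambda>x. poly p (complex_of_real x))"
    using int unfolding poly_altdef by simp
  show "(\<integral>x. poly p (complex_of_real x) \<partial>\<mu>) = (\<Sum>i\<le>degree p. coeff p i * of_real (\<integral>x. x ^ i \<partial>\<mu>))"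
    using int unfolding poly_altdef by (simp add: Bochner_Integration.integral_sum flip: of_real_power)
qed

lemma integral_poly_cong_moments:
  assumes "real_distribution \<mu>" "finite_moments \<mu>" "real_distribution \<nu>" "finite_moments \<nu>"
    and "\<And>n. n \<ge> 1 \<Longrightarrow> (\<integral>x. x ^ n \<partial>\<nu>) = (\<integral>x. x ^ n \<partial>\<mu>)"
  shows "(\<integral>x. poly p (complex_of_real x) \<partial>\<nu>) = (\<integral>x. poly p (complex_of_real x) \<partial>\<mu>)"
proof -
  interpret m: real_distribution \<mu> by fact
  interpret n: real_distribution \<nu> by fact
  have "(\<integral>x. x ^ i \<partial>\<nu>) = (\<integral>x. x ^ i \<partial>\<mu>)" for i
    using assms(5)[of i] m.prob_space n.prob_space by (cases "i = 0") auto
  then show ?thesis using assms by (simp add: integrable_poly)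
qed

context carleman_sequence
begin

text \<open>
  The moment bound passes to \<nu>, so the weight is integrable for both distributions. A polynomial close
  to exp (i t x) in the weighted norm then has almost the integral char t for either of them, and its
  two integrals agree.
\<close>

lemma determinate:
  assumes \<mu>: "real_distribution \<mu>" "finite_moments \<mu>" and \<nu>: "real_distribution \<nu>" "finite_moments \<nu>"
    and eq: "\<And>n. n \<ge> 1 \<Longrightarrow> (\<integral>x. x ^ n \<partial>\<nu>) = (\<integral>x. x ^ n \<partial>\<mu>)"
    and bd: "\<And>n. (\<integral>x. x ^ (2 * n) \<partial>\<mu>) \<le> (M n)\<^sup>2"
  shows "\<nu> = \<mu>"
proof -
  interpret m: real_distribution \<mu> by fact
  interpret n: real_distribution \<nu> by fact
  have "(\<integral>x. x ^ (2 * n) \<partial>\<nu>) \<le> (M n)\<^sup>2" for n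
    using bd[of n] eq[of "2 * n"] m.prob_space n.prob_space by (cases "n = 0") auto
  then have W: "integrable \<nu> W" "integrable \<mu> W"
    using integrable_W \<mu> \<nu> bd by auto
  have V: "integrable N (\<lambda>x. sqrt (W x))" if "integrable N W" "real_distribution N" for N
  proof -
    interpret real_distribution N by fact
    show ?thesis
    proof (rule Bochner_Integration.integrable_bound)
      show "integrable N (\<lambda>x. 1 + W x)" using that by auto
      show "(\<lambda>x. sqrt (W x)) \<in> borel_measurable N"
        using borel_measurable_integrable[OF that(1)] by measurable
      have "sqrt (W x) \<le> 1 + W x" for x
        using W_nonneg[of x] by (intro real_le_lsqrt) (auto simp: power2_eq_square algebra_simps)
      then show "AE x in N. norm (sqrt (W x)) \<le> norm (1 + W x)" using W_nonneg by simp
    qed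
  qed
  have ie: "integrable N (\<lambda>x. iexp (t * x))" if "real_distribution N" for N t
  proof -
    interpret real_distribution N by fact
    show ?thesis by (rule integrable_iexp) auto
  qed
  have close: "cmod (char N t - (\<integral>x. poly p (complex_of_real x) \<partial>N)) \<le> \<epsilon> * (\<integral>x. sqrt (W x) \<partial>N)"
    if p: "\<And>x. cmod (iexp (t * x) - poly p (complex_of_real x)) \<le> \<epsilon> * sqrt (W x)"
      and N: "real_distribution N" "finite_moments N" "integrable N W" for N t p \<epsilon>
  proof -
    have "char N t - (\<integral>x. poly p (complex_of_real x) \<partial>N) = (\<integral>x. iexp (t * x) - poly p (complex_of_real x) \<partial>N)"
      unfolding char_def using ie integrable_poly(1) N by (intro Bochner_Integration.integral_diff[symmetric]) auto
    also have "cmod \<dots> \<le> (\<integral>x. \<epsilon> * sqrt (W x) \<partial>N)"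
      using ie integrable_poly(1) N V p
      by (intro Bochner_Integration.integral_norm_bound_integral Bochner_Integration.integrable_diff integrable_mult_right) auto
    finally show ?thesis by simp
  qed
  have "char \<nu> = char \<mu>"
  proof
    fix t
    define I where "I = (\<integral>x. sqrt (W x) \<partial>\<mu>) + (\<integral>x. sqrt (W x) \<partial>\<nu>)"
    have I: "I \<ge> 0" unfolding I_def by (intro add_nonneg_nonneg integral_nonneg) (auto simp: W_nonneg)
    have "cmod (char \<nu> t - char \<mu> t) \<le> e" if "e > 0" for e
    proof -
      define \<epsilon> where "\<epsilon> = e / (I + 1)"
      have \<epsilon>: "\<epsilon> > 0" "\<epsilon> * I \<le> e" using that I by (auto simp: \<epsilon>_def field_simps)
      obtain p where p: "\<And>x. cmod (iexp (t * x) - poly p (complex_of_real x)) \<le> \<epsilon> * sqrt (W x)"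
        using weight.iexp_poly_approx[OF \<epsilon>(1), of t] unfolding poly_approx_def by blast
      have "cmod (char \<nu> t - char \<mu> t) \<le> \<epsilon> * (\<integral>x. sqrt (W x) \<partial>\<nu>) + \<epsilon> * (\<integral>x. sqrt (W x) \<partial>\<mu>)"
        using norm_triangle_le_diff[OF add_mono[OF close[OF p \<nu> W(1)] close[OF p \<mu> W(2)]]]
          integral_poly_cong_moments[OF \<mu> \<nu> eq, of p] by simp
      also have "\<dots> = \<epsilon> * I" by (simp add: I_def algebra_simps)
      finally show ?thesis using \<epsilon> by simp
    qed
    then have "cmod (char \<nu> t - char \<mu> t) \<le> 0" by (metis field_le_epsilon add_0)
    then show "char \<nu> t = char \<mu> t" by simp
  qed
  then show ?thesis using Levy_uniqueness \<mu> \<nu> by blast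
qed

end

context moment_weight
begin

text \<open>
  Powers of cosines are trigonometric polynomials; carrying the factor exp (i t x) along closes the
  induction on the exponent.
\<close>

lemma cos_power_poly_approx:
  assumes "\<epsilon> > 0"
  shows "poly_approx V (\<lambda>x. of_real (cos (s * x)) ^ m * iexp (t * x)) \<epsilon>"
  using assms
proof (induction m arbitrary: t)
  case 0
  then show ?case using iexp_poly_approx by simp
next
  case (Suc m)
  let ?u = "\<lambda>t x. complex_of_real (cos (s * x)) ^ m * iexp (t * x)"
  have "poly_approx V (\<lambda>x. 1 / 2 * ?u (t + s) x + 1 / 2 * ?u (t - s) x) (cmod (1 / 2) * \<epsilon> + cmod (1 / 2) * \<epsilon>)"
    using Suc by (intro poly_approx_add poly_approx_cmult)
  moreover have "1 / 2 * ?u (t + s) x + 1 / 2 * ?u (t - s) x = of_real (cos (s * x)) ^ Suc m * iexp (t * x)" for x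
  proof -
    have "of_real (cos (s * x)) = (iexp (s * x) + iexp (- (s * x))) / 2"
      by (simp add: cos_exp_eq flip: cos_of_real)
    moreover have "iexp ((t + s) * x) = iexp (t * x) * iexp (s * x)" "iexp ((t - s) * x) = iexp (t * x) * iexp (- (s * x))"
      by (simp_all add: algebra_simps flip: exp_add)
    ultimately show ?thesis by (simp only: power_Suc) (simp add: algebra_simps)
  qed
  ultimately show ?case by (simp del: power_Suc)
qed

end

section \<open>The Stieltjes transform\<close>

definition stieltjes :: "real measure \<Rightarrow> complex \<Rightarrow> complex" where
  "stieltjes N z = (\<integral>x. 1 / (of_real x - z) \<partial>N)"

lemma norm_resolvent_le:
  assumes "Im z > 0"
  shows "cmod (1 / (of_real x - z)) \<le> 1 / Im z"
proof -
  have "Im z \<le> cmod (of_real x - z)" using abs_Im_le_cmod[of "of_real x - z"] assms by simp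
  then show ?thesis using assms by (simp add: norm_divide frac_le)
qed

lemma resolvent_ne_0: "Im z > 0 \<Longrightarrow> of_real x - z \<noteq> 0"
  by (auto simp: complex_eq_iff)

lemma integrable_resolvent:
  assumes "real_distribution N" "Im z > 0"
  shows "integrable N (\<lambda>x. 1 / (of_real x - z))"
proof -
  interpret real_distribution N by fact
  show ?thesis
    by (rule integrable_const_bound[where B = "1 / Im z"]) (use assms norm_resolvent_le in auto)
qed

text \<open>
  The difference quotient is compared with the expected derivative under the integral sign; the error is
  at most a multiple of |w - z|, uniformly in x.
\<close>

lemma stieltjes_holomorphic:
  assumes N: "real_distribution N"
  shows "stieltjes N holomorphic_on {z. Im z > 0}"
proof -
  interpret real_distribution N by fact
  have "(stieltjes N has_field_derivative (\<integral>x. 1 / (of_real x - z)\<^sup>2 \<partial>N)) (at z)" if z: "Im z > 0" for z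
  proof -
    define B where "B = 2 / Im z ^ 3"
    have iz2: "integrable N (\<lambda>x. 1 / (of_real x - z)\<^sup>2)"
    proof (rule integrable_const_bound[where B = "1 / (Im z)\<^sup>2"])
      show "AE x in N. cmod (1 / (of_real x - z)\<^sup>2) \<le> 1 / (Im z)\<^sup>2"
        using power_mono[OF norm_resolvent_le[OF z], of _ 2]
        by (auto simp: norm_divide norm_power power_divide)
    qed auto
    have bound: "cmod ((stieltjes N w - stieltjes N z) / (w - z) - (\<integral>x. 1 / (of_real x - z)\<^sup>2 \<partial>N)) \<le> B * cmod (w - z)"
      if w: "w \<noteq> z" "cmod (w - z) < Im z / 2" for w
    proof -
      have Imw: "Im w > Im z / 2" using abs_Im_le_cmod[of "w - z"] w by auto
      then have Imw0: "Im w > 0" using z by simp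
      have eq: "(1 / (of_real x - w) - 1 / (of_real x - z)) / (w - z) - 1 / (of_real x - z)\<^sup>2
          = (w - z) * (1 / (of_real x - w)) * (1 / (of_real x - z))\<^sup>2" for x
        using resolvent_ne_0[OF z, of x] resolvent_ne_0[OF Imw0, of x] w(1)
        by (simp add: divide_simps power2_eq_square)
      have "(stieltjes N w - stieltjes N z) / (w - z) - (\<integral>x. 1 / (of_real x - z)\<^sup>2 \<partial>N)
        = (\<integral>x. (1 / (of_real x - w) - 1 / (of_real x - z)) / (w - z) - 1 / (of_real x - z)\<^sup>2 \<partial>N)"
        unfolding stieltjes_def using integrable_resolvent[OF N] z Imw0 iz2 by simp
      also have "cmod \<dots> \<le> (\<integral>x. B * cmod (w - z) \<partial>N)"
      proof (rule Bochner_Integration.integral_norm_bound_integral)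
        show "integrable N (\<lambda>x. (1 / (of_real x - w) - 1 / (of_real x - z)) / (w - z) - 1 / (of_real x - z)\<^sup>2)"
          using integrable_resolvent[OF N] z Imw0 iz2 by simp
        fix x
        have "cmod (1 / (of_real x - w)) \<le> 2 / Im z"
        proof -
          have "1 / Im w \<le> 2 / Im z" using Imw z by (simp add: field_simps)
          then show ?thesis using norm_resolvent_le[OF Imw0, of x] by simp
        qed
        moreover have "cmod ((1 / (of_real x - z))\<^sup>2) \<le> (1 / Im z)\<^sup>2"
          unfolding norm_power by (intro power_mono norm_resolvent_le z) auto
        ultimately have "cmod ((w - z) * (1 / (of_real x - w)) * (1 / (of_real x - z))\<^sup>2)
            \<le> cmod (w - z) * (2 / Im z) * (1 / Im z)\<^sup>2"
          unfolding norm_mult using z by (intro mult_mono) auto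
        then show "cmod ((1 / (of_real x - w) - 1 / (of_real x - z)) / (w - z) - 1 / (of_real x - z)\<^sup>2) \<le> B * cmod (w - z)"
          unfolding eq by (simp add: B_def power3_eq_cube power2_eq_square mult_ac)
      qed simp
      also have "\<dots> = B * cmod (w - z)" using prob_space by simp
      finally show ?thesis .
    qed
    have "((\<lambda>w. (stieltjes N w - stieltjes N z) / (w - z) - (\<integral>x. 1 / (of_real x - z)\<^sup>2 \<partial>N)) \<longlongrightarrow> 0) (at z)"
    proof (rule Lim_null_comparison)
      have "\<forall>\<^sub>F w in at z. w \<noteq> z \<and> cmod (w - z) < Im z / 2"
        using z by (auto simp: eventually_at dist_norm intro!: exI[of _ "Im z / 2"])
      then show "\<forall>\<^sub>F w in at z. cmod ((stieltjes N w - stieltjes N z) / (w - z) - (\<integral>x. 1 / (of_real x - z)\<^sup>2 \<partial>N)) \<le> B * cmod (w - z)"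
        by eventually_elim (use bound in auto)
      show "((\<lambda>w. B * cmod (w - z)) \<longlongrightarrow> 0) (at z)"
        by (auto intro!: tendsto_eq_intros)
    qed
    then show ?thesis
      unfolding has_field_derivative_iff by (simp add: LIM_zero_iff)
  qed
  then show ?thesis
    unfolding holomorphic_on_open[OF open_halfspace_Im_gt] by blast
qed

lemma integrable_cauchy_density: "integrable lborel (\<lambda>u::real. 1 / (1 + u\<^sup>2))"
  using integrable_inverse_1_plus_square by (simp add: set_integrable_def inverse_eq_divide)

lemma cauchy_kernel_integral:
  fixes x \<theta> y :: real
  assumes y: "y > 0"
  shows "integrable lborel (\<lambda>t. iexp (\<theta> * t) * of_real (y / ((x - t)\<^sup>2 + y\<^sup>2)))"
    and "(\<integral>t. iexp (\<theta> * t) * of_real (y / ((x - t)\<^sup>2 + y\<^sup>2)) \<partial>lborel)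
       = iexp (\<theta> * x) * (\<integral>u. iexp (\<theta> * y * u) * of_real (1 / (1 + u\<^sup>2)) \<partial>lborel)"
    and "integrable lborel (\<lambda>t. y / ((x - t)\<^sup>2 + y\<^sup>2))"
    and "(\<integral>t. y / ((x - t)\<^sup>2 + y\<^sup>2) \<partial>lborel) = (\<integral>u. 1 / (1 + u\<^sup>2) \<partial>lborel)"
proof -
  have k: "y / ((x - (x + y * u))\<^sup>2 + y\<^sup>2) = 1 / y * (1 / (1 + u\<^sup>2))" for u
  proof -
    have "y / ((x - (x + y * u))\<^sup>2 + y\<^sup>2) = y / (y * (y * (1 + u\<^sup>2)))"
      by (simp add: power_mult_distrib power2_eq_square algebra_simps)
    also have "\<dots> = 1 / y * (1 / (1 + u\<^sup>2))"
      using y by (subst nonzero_divide_mult_cancel_left) auto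
    finally show ?thesis .
  qed
  show 3: "integrable lborel (\<lambda>t. y / ((x - t)\<^sup>2 + y\<^sup>2))"
    using lborel_integrable_real_affine_iff[of y "\<lambda>t. y / ((x - t)\<^sup>2 + y\<^sup>2)" x] y
      integrable_mult_right[OF integrable_cauchy_density, of "1 / y"] unfolding k by simp
  show "(\<integral>t. y / ((x - t)\<^sup>2 + y\<^sup>2) \<partial>lborel) = (\<integral>u. 1 / (1 + u\<^sup>2) \<partial>lborel)"
  proof -
    have "(\<integral>t. y / ((x - t)\<^sup>2 + y\<^sup>2) \<partial>lborel) = \<bar>y\<bar> *\<^sub>R (\<integral>u. y / ((x - (x + y * u))\<^sup>2 + y\<^sup>2) \<partial>lborel)"
      by (rule lborel_integral_real_affine) (use y in simp)
    also have "\<dots> = \<bar>y\<bar> *\<^sub>R (1 / y * (\<integral>u. 1 / (1 + u\<^sup>2) \<partial>lborel))"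
      unfolding k by (subst integral_mult_right_zero) simp
    also have "\<dots> = (\<integral>u. 1 / (1 + u\<^sup>2) \<partial>lborel)" using y by simp
    finally show ?thesis .
  qed
  show "integrable lborel (\<lambda>t. iexp (\<theta> * t) * of_real (y / ((x - t)\<^sup>2 + y\<^sup>2)))"
  proof (rule Bochner_Integration.integrable_bound[OF 3])
    show "(\<lambda>t. iexp (\<theta> * t) * complex_of_real (y / ((x - t)\<^sup>2 + y\<^sup>2))) \<in> borel_measurable lborel"
      by measurable
    show "AE t in lborel. norm (iexp (\<theta> * t) * complex_of_real (y / ((x - t)\<^sup>2 + y\<^sup>2))) \<le> norm (y / ((x - t)\<^sup>2 + y\<^sup>2))"
      by (intro AE_I2) (simp only: norm_mult norm_exp_i_times norm_of_real real_norm_def mult_1 order_refl)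
  qed
  have e: "iexp (\<theta> * (x + y * u)) = iexp (\<theta> * x) * iexp (\<theta> * y * u)" for u
    by (simp add: algebra_simps flip: exp_add)
  have "(\<integral>t. iexp (\<theta> * t) * of_real (y / ((x - t)\<^sup>2 + y\<^sup>2)) \<partial>lborel)
     = y *\<^sub>R (\<integral>u. iexp (\<theta> * (x + y * u)) * of_real (y / ((x - (x + y * u))\<^sup>2 + y\<^sup>2)) \<partial>lborel)"
    using y by (subst lborel_integral_real_affine[of y _ x]) auto
  also have "\<dots> = y *\<^sub>R (\<integral>u. (iexp (\<theta> * x) / y) * (iexp (\<theta> * y * u) * of_real (1 / (1 + u\<^sup>2))) \<partial>lborel)"
  proof -
    have alg: "A * B * (1 / Y * D) = A / Y * (B * D)" for A B Y D :: complex by simp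
    have "iexp (\<theta> * (x + y * u)) * of_real (y / ((x - (x + y * u))\<^sup>2 + y\<^sup>2))
      = (iexp (\<theta> * x) / y) * (iexp (\<theta> * y * u) * of_real (1 / (1 + u\<^sup>2)))" for u
    proof -
      have "complex_of_real (y / ((x - (x + y * u))\<^sup>2 + y\<^sup>2)) = 1 / complex_of_real y * complex_of_real (1 / (1 + u\<^sup>2))"
        unfolding k by (simp only: of_real_mult of_real_divide[of 1 y] of_real_1)
      then show ?thesis unfolding e by (simp only: alg)
    qed
    then show ?thesis by (simp only:)
  qed
  also have "\<dots> = y *\<^sub>R ((iexp (\<theta> * x) / y) * (\<integral>u. iexp (\<theta> * y * u) * of_real (1 / (1 + u\<^sup>2)) \<partial>lborel))"
    by (subst integral_mult_right_zero) simp
  also have "\<dots> = iexp (\<theta> * x) * (\<integral>u. iexp (\<theta> * y * u) * of_real (1 / (1 + u\<^sup>2)) \<partial>lborel)"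
    using y by (simp add: scaleR_conv_of_real)
  finally show "(\<integral>t. iexp (\<theta> * t) * of_real (y / ((x - t)\<^sup>2 + y\<^sup>2)) \<partial>lborel)
       = iexp (\<theta> * x) * (\<integral>u. iexp (\<theta> * y * u) * of_real (1 / (1 + u\<^sup>2)) \<partial>lborel)" .
qed

text \<open>
  The characteristic function of the Cauchy distribution, up to normalisation. It tends to a positive
  number as the scale y tends to 0, which is all that the inversion argument needs.
\<close>

lemma cauchy_char_ne_0:
  fixes \<theta> :: real
  obtains y :: real where "y > 0" "(\<integral>u. iexp (\<theta> * y * u) * complex_of_real (1 / (1 + u\<^sup>2)) \<partial>lborel) \<noteq> 0"
proof -
  define c where "c n = (\<integral>u. iexp (\<theta> * (1 / real (Suc n)) * u) * complex_of_real (1 / (1 + u\<^sup>2)) \<partial>lborel)" for n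
  have "c \<longlonglongrightarrow> (\<integral>u. complex_of_real (1 / (1 + u\<^sup>2)) \<partial>lborel)"
    unfolding c_def
  proof (rule integral_dominated_convergence[where w = "\<lambda>u. 1 / (1 + u\<^sup>2)"])
    show "AE u in lborel. (\<lambda>n. iexp (\<theta> * (1 / real (Suc n)) * u) * complex_of_real (1 / (1 + u\<^sup>2))) \<longlonglongrightarrow> complex_of_real (1 / (1 + u\<^sup>2))"
    proof (rule AE_I2)
      fix u :: real
      have "(\<lambda>n. \<theta> * (1 / real (Suc n)) * u) \<longlonglongrightarrow> \<theta> * 0 * u"
        by (intro tendsto_mult tendsto_const LIMSEQ_Suc[OF lim_1_over_n])
      then have "(\<lambda>n. iexp (\<theta> * (1 / real (Suc n)) * u) * complex_of_real (1 / (1 + u\<^sup>2))) \<longlonglongrightarrow> iexp (\<theta> * 0 * u) * complex_of_real (1 / (1 + u\<^sup>2))"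
        by (rule tendsto_mult[OF tendsto_exp[OF tendsto_mult[OF tendsto_const tendsto_of_real]] tendsto_const])
      then show "(\<lambda>n. iexp (\<theta> * (1 / real (Suc n)) * u) * complex_of_real (1 / (1 + u\<^sup>2))) \<longlonglongrightarrow> complex_of_real (1 / (1 + u\<^sup>2))"
        by simp
    qed
    show "integrable lborel (\<lambda>u::real. 1 / (1 + u\<^sup>2))" by (rule integrable_cauchy_density)
  qed (auto simp: norm_mult norm_divide simp del: of_real_add of_real_divide of_real_1 of_real_power)
  moreover have "(\<integral>u. complex_of_real (1 / (1 + u\<^sup>2)) \<partial>lborel) = complex_of_real (\<integral>u. 1 / (1 + u\<^sup>2) \<partial>lborel)"
    by (rule integral_complex_of_real)
  moreover have "(\<integral>u. 1 / (1 + u\<^sup>2) \<partial>lborel) \<noteq> (0::real)"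
  proof
    assume "(\<integral>u. 1 / (1 + u\<^sup>2) \<partial>lborel) = (0::real)"
    then have "AE u::real in lborel. 1 / (1 + u\<^sup>2) = 0"
      using integral_nonneg_eq_0_iff_AE[OF integrable_cauchy_density] by simp
    then have "AE u::real in lborel. False"
      by eventually_elim (simp add: add_nonneg_eq_0_iff)
    then have "(UNIV :: real set) \<in> null_sets lborel"
      using AE_iff_null[of "lborel :: real measure" "\<lambda>_. False"] by simp
    then show False by (simp add: null_sets_def)
  qed
  ultimately have "\<forall>\<^sub>F n in sequentially. c n \<noteq> 0"
    by (intro tendsto_imp_eventually_ne) auto
  then obtain n where "c n \<noteq> 0" by (auto simp: eventually_sequentially)
  then show ?thesis using that[of "1 / real (Suc n)"] by (simp add: c_def)
qed

text \<open>
  Convolution with the Cauchy kernel multiplies characteristic functions.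
\<close>

lemma poisson_integral_char:
  assumes N: "real_distribution N" and y: "y > 0"
  shows "(\<integral>t. iexp (\<theta> * t) * of_real (\<integral>x. y / ((x - t)\<^sup>2 + y\<^sup>2) \<partial>N) \<partial>lborel)
    = char N \<theta> * (\<integral>u. iexp (\<theta> * y * u) * of_real (1 / (1 + u\<^sup>2)) \<partial>lborel)"
proof -
  interpret real_distribution N by fact
  interpret P: pair_sigma_finite N lborel ..
  define k where "k = (\<lambda>(x, t). iexp (\<theta> * t) * complex_of_real (y / ((x - t)\<^sup>2 + y\<^sup>2)))"
  have m: "k \<in> borel_measurable (N \<Otimes>\<^sub>M lborel)" unfolding k_def by measurable
  have "integrable (N \<Otimes>\<^sub>M lborel) k"
  proof (rule P.Fubini_integrable[OF m])
    have "(\<lambda>x. \<integral>t. norm (k (x, t)) \<partial>lborel) = (\<lambda>x. \<integral>u. 1 / (1 + u\<^sup>2) \<partial>lborel)"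
      using cauchy_kernel_integral(4)[OF y] y by (simp add: k_def norm_mult abs_of_nonneg del: of_real_divide of_real_add of_real_power)
    then show "integrable N (\<lambda>x. \<integral>t. norm (k (x, t)) \<partial>lborel)" by simp
    show "AE x in N. integrable lborel (\<lambda>t. k (x, t))"
      using cauchy_kernel_integral(1)[OF y] by (simp add: k_def)
  qed
  then have "integrable (N \<Otimes>\<^sub>M lborel) (\<lambda>(x, t). k (x, t))" by simp
  then have F: "(\<integral>t. (\<integral>x. k (x, t) \<partial>N) \<partial>lborel) = (\<integral>x. (\<integral>t. k (x, t) \<partial>lborel) \<partial>N)"
    by (rule P.Fubini_integral[of "\<lambda>x t. k (x, t)"])
  have "(\<integral>x. k (x, t) \<partial>N) = iexp (\<theta> * t) * of_real (\<integral>x. y / ((x - t)\<^sup>2 + y\<^sup>2) \<partial>N)" for t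
    unfolding k_def by (simp only: prod.case integral_mult_right_zero integral_complex_of_real)
  moreover have "(\<integral>t. k (x, t) \<partial>lborel) = iexp (\<theta> * x) * (\<integral>u. iexp (\<theta> * y * u) * of_real (1 / (1 + u\<^sup>2)) \<partial>lborel)" for x
    unfolding k_def prod.case by (rule cauchy_kernel_integral(2)[OF y])
  ultimately show ?thesis using F unfolding char_def by simp
qed

text \<open>
  The imaginary part of the Stieltjes transform is the convolution with the Cauchy kernel, whose
  characteristic function can be divided out.
\<close>

theorem stieltjes_unique:
  assumes \<mu>: "real_distribution \<mu>" and \<nu>: "real_distribution \<nu>"
    and eq: "\<And>z. Im z > 0 \<Longrightarrow> stieltjes \<mu> z = stieltjes \<nu> z"
  shows "\<mu> = \<nu>"
proof -
  have poisson: "(\<integral>x. y / ((x - t)\<^sup>2 + y\<^sup>2) \<partial>N) = Im (stieltjes N (Complex t y))"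
    if "real_distribution N" "y > 0" for N t y
  proof -
    have "Im (1 / (of_real x - Complex t y)) = y / ((x - t)\<^sup>2 + y\<^sup>2)" for x
      by (simp add: Im_divide power2_eq_square)
    then show ?thesis
      unfolding stieltjes_def using integral_Im[OF integrable_resolvent[OF that(1), of "Complex t y"]] that(2) by simp
  qed
  have "char \<mu> = char \<nu>"
  proof
    fix \<theta>
    obtain y where y: "y > 0" "(\<integral>u. iexp (\<theta> * y * u) * complex_of_real (1 / (1 + u\<^sup>2)) \<partial>lborel) \<noteq> 0"
      by (rule cauchy_char_ne_0)
    have "(\<integral>x. y / ((x - t)\<^sup>2 + y\<^sup>2) \<partial>\<mu>) = (\<integral>x. y / ((x - t)\<^sup>2 + y\<^sup>2) \<partial>\<nu>)" for t
      using poisson[OF \<mu> y(1)] poisson[OF \<nu> y(1)] eq[of "Complex t y"] y by simp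
    then show "char \<mu> \<theta> = char \<nu> \<theta>"
      using poisson_integral_char[OF \<mu> y(1), of \<theta>] poisson_integral_char[OF \<nu> y(1), of \<theta>] y(2) by simp
  qed
  then show ?thesis using Levy_uniqueness \<mu> \<nu> by blast
qed

section \<open>Point evaluation of polynomials for indeterminate moments\<close>

definition poly_L2 :: "real measure \<Rightarrow> complex poly \<Rightarrow> real" where
  "poly_L2 N p = sqrt (\<integral>x. (cmod (poly p (of_real x)))\<^sup>2 \<partial>N)"

lemma cmod_sq_poly: "complex_of_real ((cmod (poly p (of_real x)))\<^sup>2) = poly (p * map_poly cnj p) (of_real x)"
proof -
  have "cnj (poly p (of_real x)) = poly (map_poly cnj p) (of_real x)"
    using poly_cnj[of p "of_real x"] by simp
  then show ?thesis by (simp only: complex_norm_square poly_mult)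
qed

lemma integrable_cmod_sq_poly:
  assumes "real_distribution N" "finite_moments N"
  shows "integrable N (\<lambda>x. (cmod (poly p (of_real x)))\<^sup>2)"
proof -
  have "integrable N (\<lambda>x. Re (poly (p * map_poly cnj p) (of_real x)))"
    by (intro integrable_Re integrable_poly assms)
  then show ?thesis unfolding cmod_sq_poly[symmetric] by simp
qed

text \<open>
  On the real line the squared modulus of a polynomial is again a polynomial.
\<close>

lemma poly_L2_cong_moments:
  assumes "real_distribution \<mu>" "finite_moments \<mu>" "real_distribution \<nu>" "finite_moments \<nu>"
    and "\<And>n. n \<ge> 1 \<Longrightarrow> (\<integral>x. x ^ n \<partial>\<nu>) = (\<integral>x. x ^ n \<partial>\<mu>)"
  shows "poly_L2 \<nu> p = poly_L2 \<mu> p"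
proof -
  have "complex_of_real (\<integral>x. (cmod (poly p (of_real x)))\<^sup>2 \<partial>\<nu>) = of_real (\<integral>x. (cmod (poly p (of_real x)))\<^sup>2 \<partial>\<mu>)"
    using integral_poly_cong_moments[OF assms, of "p * map_poly cnj p"]
    unfolding cmod_sq_poly[symmetric] integral_complex_of_real .
  then show ?thesis unfolding poly_L2_def by (simp only: of_real_eq_iff)
qed

lemma integral_cmod_poly_le:
  assumes N: "real_distribution N" "finite_moments N"
  shows "integrable N (\<lambda>x. cmod (poly p (of_real x)))"
    and "(\<integral>x. cmod (poly p (of_real x)) \<partial>N) \<le> poly_L2 N p"
proof -
  interpret real_distribution N by fact
  show i: "integrable N (\<lambda>x. cmod (poly p (of_real x)))"
    by (intro integrable_norm integrable_poly N)
  have "0 \<le> variance (\<lambda>x. cmod (poly p (of_real x)))" by (rule variance_positive)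
  also have "\<dots> = (\<integral>x. (cmod (poly p (of_real x)))\<^sup>2 \<partial>N) - (\<integral>x. cmod (poly p (of_real x)) \<partial>N)\<^sup>2"
    by (rule variance_eq[OF i integrable_cmod_sq_poly[OF N]])
  finally show "(\<integral>x. cmod (poly p (of_real x)) \<partial>N) \<le> poly_L2 N p"
    unfolding poly_L2_def by (intro real_le_rsqrt) simp
qed

text \<open>
  Dividing p - p(z) by x - z leaves a polynomial, whose integral depends on the moments only; it will
  cancel between two distributions with equal moments.
\<close>

lemma poly_stieltjes_identity:
  assumes N: "real_distribution N" "finite_moments N" and z: "Im z > 0"
  shows "poly p z * stieltjes N z =
     (\<integral>x. poly p (of_real x) * (1 / (of_real x - z)) \<partial>N) - (\<integral>x. poly (synthetic_div p z) (of_real x) \<partial>N)"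
    and "cmod (\<integral>x. poly p (of_real x) * (1 / (of_real x - z)) \<partial>N) \<le> poly_L2 N p / Im z"
proof -
  interpret real_distribution N by fact
  have b: "cmod (poly p (of_real x) * (1 / (of_real x - z))) \<le> cmod (poly p (of_real x)) * (1 / Im z)" for x
    unfolding norm_mult by (intro mult_left_mono norm_resolvent_le z) simp
  have i: "integrable N (\<lambda>x. poly p (of_real x) * (1 / (of_real x - z)))"
  proof (rule Bochner_Integration.integrable_bound)
    show "integrable N (\<lambda>x. cmod (poly p (of_real x)) * (1 / Im z))"
      by (intro integrable_mult_left integral_cmod_poly_le N)
    show "(\<lambda>x. poly p (of_real x) * (1 / (of_real x - z))) \<in> borel_measurable N"
      using borel_measurable_integrable[OF integrable_poly(1)[OF N]] by measurable
    show "AE x in N. norm (poly p (of_real x) * (1 / (of_real x - z))) \<le> norm (cmod (poly p (of_real x)) * (1 / Im z))"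
      using b z by simp
  qed
  have eq: "poly p z * (1 / (of_real x - z)) = poly p (of_real x) * (1 / (of_real x - z)) - poly (synthetic_div p z) (of_real x)" for x
  proof -
    have "poly ([:-z, 1:] * synthetic_div p z + [:poly p z:]) (of_real x) = poly p (of_real x)"
      by (simp only: synthetic_div_correct')
    then have "poly p (of_real x) = (of_real x - z) * poly (synthetic_div p z) (of_real x) + poly p z"
      by (simp add: algebra_simps)
    then show ?thesis using resolvent_ne_0[OF z, of x] by (simp add: field_simps)
  qed
  show "poly p z * stieltjes N z =
     (\<integral>x. poly p (of_real x) * (1 / (of_real x - z)) \<partial>N) - (\<integral>x. poly (synthetic_div p z) (of_real x) \<partial>N)"
    unfolding stieltjes_def integral_mult_right_zero[symmetric] eq
    by (intro Bochner_Integration.integral_diff i integrable_poly N)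
  have "cmod (\<integral>x. poly p (of_real x) * (1 / (of_real x - z)) \<partial>N) \<le> (\<integral>x. cmod (poly p (of_real x)) * (1 / Im z) \<partial>N)"
    by (intro Bochner_Integration.integral_norm_bound_integral i b integrable_mult_left integral_cmod_poly_le N)
  also have "\<dots> = (\<integral>x. cmod (poly p (of_real x)) \<partial>N) * (1 / Im z)" by simp
  also have "\<dots> \<le> poly_L2 N p * (1 / Im z)"
    using z by (intro mult_right_mono integral_cmod_poly_le N) auto
  finally show "cmod (\<integral>x. poly p (of_real x) * (1 / (of_real x - z)) \<partial>N) \<le> poly_L2 N p / Im z" by simp
qed

text \<open>
  Wherever the two Stieltjes transforms differ, evaluation at z is continuous in the L2 norm of \<mu>.
\<close>

lemma poly_eval_le:
  assumes \<mu>: "real_distribution \<mu>" "finite_moments \<mu>" and \<nu>: "real_distribution \<nu>" "finite_moments \<nu>"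
    and eq: "\<And>n. n \<ge> 1 \<Longrightarrow> (\<integral>x. x ^ n \<partial>\<nu>) = (\<integral>x. x ^ n \<partial>\<mu>)"
    and z: "Im z > 0"
  shows "cmod (poly p z) * cmod (stieltjes \<nu> z - stieltjes \<mu> z) \<le> 2 / Im z * poly_L2 \<mu> p"
proof -
  have "poly p z * (stieltjes \<nu> z - stieltjes \<mu> z)
     = (\<integral>x. poly p (of_real x) * (1 / (of_real x - z)) \<partial>\<nu>) - (\<integral>x. poly p (of_real x) * (1 / (of_real x - z)) \<partial>\<mu>)"
    unfolding right_diff_distrib poly_stieltjes_identity(1)[OF \<mu> z] poly_stieltjes_identity(1)[OF \<nu> z]
    using integral_poly_cong_moments[OF \<mu> \<nu> eq] by simp
  moreover have "cmod \<dots> \<le> poly_L2 \<nu> p / Im z + poly_L2 \<mu> p / Im z"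
    by (intro norm_triangle_le_diff add_mono poly_stieltjes_identity(2) \<mu> \<nu> z)
  ultimately show ?thesis
    using poly_L2_cong_moments[OF \<mu> \<nu> eq, of p] by (simp flip: norm_mult)
qed

text \<open>
  Reflect all roots into the closed lower half-plane. This changes no modulus on the real line, and moving
  up then increases the distance to every root. It transports bounds from a line in the upper
  half-plane down to the real line and below.
\<close>

lemma poly_reflect_roots:
  fixes p :: "complex poly"
  obtains q where "\<And>x::real. cmod (poly q (of_real x)) = cmod (poly p (of_real x))"
    and "\<And>t y Y. \<bar>y\<bar> \<le> Y \<Longrightarrow> cmod (poly p (Complex t y)) \<le> cmod (poly q (Complex t Y))"
proof (cases "p = 0")
  case True
  then show ?thesis using that[of 0] by simp
next
  case False
  define refl where "refl z = Complex (Re z) (- \<bar>Im z\<bar>)" for z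
  obtain A where A: "p = smult (lead_coeff p) (\<Prod>x\<in>#A. [:-x, 1:])"
    using alg_closed_imp_factorization[OF False] by auto
  define q where "q = smult (lead_coeff p) (\<Prod>x\<in>#A. [:-refl x, 1:])"
  have prod_eq: "cmod (poly (\<Prod>x\<in>#A. [:-g x, 1:]) w) = (\<Prod>x\<in>#A. cmod (w - g x))"
    for g :: "complex \<Rightarrow> complex" and A w
  proof (induction A)
    case (add a A)
    have "poly (\<Prod>x\<in>#add_mset a A. [:-g x, 1:]) w = (w - g a) * poly (\<Prod>x\<in>#A. [:-g x, 1:]) w"
      by (simp add: algebra_simps)
    then show ?case using add by (simp only: norm_mult) simp
  qed simp
  have p_eq: "cmod (poly p w) = cmod (lead_coeff p) * (\<Prod>x\<in>#A. cmod (w - x))" for w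
    using prod_eq[of "\<lambda>x. x" A w] by (subst A) (simp add: norm_mult)
  have q_eq: "cmod (poly q w) = cmod (lead_coeff p) * (\<Prod>x\<in>#A. cmod (w - refl x))" for w
    unfolding q_def by (simp add: norm_mult prod_eq)
  show ?thesis
  proof
    fix x :: real
    have "cmod (of_real x - refl z) = cmod (of_real x - z)" for z
      by (simp add: refl_def cmod_def)
    then show "cmod (poly q (of_real x)) = cmod (poly p (of_real x))" unfolding p_eq q_eq by simp
  next
    fix t y Y :: real assume y: "\<bar>y\<bar> \<le> Y"
    have le: "cmod (Complex t y - z) \<le> cmod (Complex t Y - refl z)" for z
    proof -
      have "\<bar>y - Im z\<bar> \<le> \<bar>Y + \<bar>Im z\<bar>\<bar>" using y by linarith
      then have "(y - Im z)\<^sup>2 \<le> (Y + \<bar>Im z\<bar>)\<^sup>2" by (simp only: abs_le_square_iff)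
      then show ?thesis by (simp add: refl_def cmod_def)
    qed
    have "(\<Prod>x\<in>#A. cmod (Complex t y - x)) \<le> (\<Prod>x\<in>#A. cmod (Complex t Y - refl x))
       \<and> 0 \<le> (\<Prod>x\<in>#A. cmod (Complex t y - x))"
    proof (induction A)
      case (add a A)
      then show ?case using le[of a] by (auto intro!: mult_mono)
    qed simp
    then show "cmod (poly p (Complex t y)) \<le> cmod (poly q (Complex t Y))"
      unfolding p_eq q_eq by (intro mult_left_mono) auto
  qed
qed

text \<open>
  The difference D of the Stieltjes transforms is not identically zero, so its zeros are countable and
  some horizontal line at height Y contains none. On compact parts of that line D is bounded away from
  zero, and reflecting roots extends the resulting bound to the strip of height Y around the real line.
\<close>

lemma poly_eval_bound_strip:
  assumes \<mu>: "real_distribution \<mu>" "finite_moments \<mu>" and \<nu>: "real_distribution \<nu>" "finite_moments \<nu>"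
    and eq: "\<And>n. n \<ge> 1 \<Longrightarrow> (\<integral>x. x ^ n \<partial>\<nu>) = (\<integral>x. x ^ n \<partial>\<mu>)"
    and ne: "\<nu> \<noteq> \<mu>"
  obtains Y where "Y > 0"
    and "\<And>R. \<exists>K\<ge>0. \<forall>p w. \<bar>Re w\<bar> \<le> R \<longrightarrow> \<bar>Im w\<bar> \<le> Y \<longrightarrow> cmod (poly p w) \<le> K * poly_L2 \<mu> p"
proof -
  define H where "H = {z::complex. Im z > 0}"
  define D where "D z = stieltjes \<nu> z - stieltjes \<mu> z" for z
  have hol: "D holomorphic_on H"
    unfolding D_def H_def by (intro holomorphic_intros stieltjes_holomorphic \<mu> \<nu>)
  obtain z0 where z0: "z0 \<in> H" "D z0 \<noteq> 0"
    using stieltjes_unique[OF \<nu>(1) \<mu>(1)] ne unfolding H_def D_def by auto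
  have openH: "open H" unfolding H_def by (rule open_halfspace_Im_gt)
  have "countable {z\<in>H. D z = 0}"
  proof (cases "D constant_on H")
    case True
    then have "{z\<in>H. D z = 0} = {}" using z0 unfolding constant_on_def by auto
    then show ?thesis by (simp only: countable_empty)
  next
    case False
    have "connected H" unfolding H_def by (intro convex_connected convex_halfspace_Im_gt)
    moreover have "fsigma H"
    proof -
      obtain C :: "nat \<Rightarrow> complex set" where "\<And>n. compact (C n)" "\<Union> (range C) = H"
        using open_Union_compact_subsets[OF openH] by metis
      then show ?thesis unfolding fsigma_Union_compact by (intro exI[of _ C]) auto
    qed
    ultimately show ?thesis using holomorphic_countable_zeros[OF hol openH _ _ False] by blast
  qed
  then have "countable (Im ` {z\<in>H. D z = 0})" by (rule countable_image)
  moreover have "uncountable {0<..<1::real}" by (rule uncountable_open_interval[THEN iffD2]) simp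
  ultimately obtain Y where Y: "0 < Y" "Y \<notin> Im ` {z\<in>H. D z = 0}"
    by (metis (no_types, lifting) countable_subset greaterThanLessThan_iff subsetI)
  have D_ne: "D (Complex t Y) \<noteq> 0" for t
    using Y by (auto simp: H_def image_iff)
  show ?thesis
  proof
    show "Y > 0" by fact
    fix R
    define L where "L = (\<lambda>t. Complex t Y) ` {-R..R}"
    have "continuous_on {-R..R} (\<lambda>t. Complex t Y)" by (intro continuous_intros)
    then have "compact L" unfolding L_def by (intro compact_continuous_image) auto
    moreover have "continuous_on L (\<lambda>z. cmod (D z))"
      by (intro continuous_intros continuous_on_subset[OF holomorphic_on_imp_continuous_on[OF hol]])
        (auto simp: L_def H_def Y)
    ultimately obtain d where d: "d > 0" "\<And>z. z \<in> L \<Longrightarrow> d \<le> cmod (D z)"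
    proof (cases "L = {}")
      case False
      obtain z where z: "z \<in> L" "\<And>w. w \<in> L \<Longrightarrow> cmod (D z) \<le> cmod (D w)"
        using continuous_attains_inf[OF \<open>compact L\<close> False \<open>continuous_on L (\<lambda>z. cmod (D z))\<close>] by auto
      have "cmod (D z) > 0" using z D_ne by (auto simp: L_def)
      with z that show ?thesis by blast
    qed (use that[of 1] in auto)
    have "cmod (poly p w) \<le> 2 / (Y * d) * poly_L2 \<mu> p" if w: "\<bar>Re w\<bar> \<le> R" "\<bar>Im w\<bar> \<le> Y" for p w
    proof -
      obtain q where q: "\<And>x::real. cmod (poly q (of_real x)) = cmod (poly p (of_real x))"
        "\<And>t y Y. \<bar>y\<bar> \<le> Y \<Longrightarrow> cmod (poly p (Complex t y)) \<le> cmod (poly q (Complex t Y))"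
        by (rule poly_reflect_roots[of p]) blast
      define z where "z = Complex (Re w) Y"
      have zL: "z \<in> L" unfolding z_def L_def using w by (intro imageI) auto
      have "cmod (poly q z) * d \<le> cmod (poly q z) * cmod (D z)"
        by (intro mult_left_mono d zL) simp
      also have "\<dots> \<le> 2 / Y * poly_L2 \<mu> q"
        using poly_eval_le[OF \<mu> \<nu> eq, of z q] Y by (simp add: D_def z_def)
      also have "poly_L2 \<mu> q = poly_L2 \<mu> p" unfolding poly_L2_def q ..
      finally have "cmod (poly q z) \<le> 2 / (Y * d) * poly_L2 \<mu> p"
        using d(1) Y by (simp add: field_simps)
      moreover have "cmod (poly p w) \<le> cmod (poly q z)"
        using q(2)[OF w(2), of "Re w"] by (simp add: z_def)
      ultimately show ?thesis by simp
    qed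
    then show "\<exists>K\<ge>0. \<forall>p w. \<bar>Re w\<bar> \<le> R \<longrightarrow> \<bar>Im w\<bar> \<le> Y \<longrightarrow> cmod (poly p w) \<le> K * poly_L2 \<mu> p"
      using d(1) Y by (intro exI[of _ "2 / (Y * d)"]) auto
  qed
qed

section \<open>A criterion for determinacy on the whole line\<close>

lemma cmod_diff_sq_le: "(cmod (a - c))\<^sup>2 \<le> 2 * (cmod (a - b))\<^sup>2 + 2 * (cmod (b - c))\<^sup>2"
proof -
  have "(cmod (a - c))\<^sup>2 \<le> (cmod (a - b) + cmod (b - c))\<^sup>2"
    using norm_triangle_ineq[of "a - b" "b - c"] by (intro power_mono) auto
  also have "\<dots> \<le> 2 * (cmod (a - b))\<^sup>2 + 2 * (cmod (b - c))\<^sup>2"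
    using sum_squares_bound[of "cmod (a - b)" "cmod (b - c)"] by (simp add: power2_sum)
  finally show ?thesis .
qed

text \<open>
  Uniform and mean-square limits on the interval coincide almost everywhere.
\<close>

lemma AE_zero_of_uniform_limit:
  fixes Q :: "complex \<Rightarrow> complex"
  assumes N: "real_distribution N" and ab: "a \<le> b"
    and Q: "continuous_on (of_real ` {a..b}) Q"
    and m: "\<And>n. q n \<in> borel_measurable borel" "\<And>n. integrable N (\<lambda>x. (cmod (q n x))\<^sup>2 * indicator {a..b} x)"
    and unif: "\<And>n x. x \<in> {a..b} \<Longrightarrow> cmod (Q (of_real x) - q n x) \<le> \<delta> n" and \<delta>: "\<delta> \<longlonglongrightarrow> 0"
    and q0: "(\<lambda>n. \<integral>x. (cmod (q n x))\<^sup>2 * indicator {a..b} x \<partial>N) \<longlonglongrightarrow> 0"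
  shows "AE x in N. x \<in> {a..b} \<longrightarrow> Q (of_real x) = 0"
proof -
  interpret real_distribution N by fact
  define h where "h x = (cmod (Q (of_real x)))\<^sup>2 * indicator {a..b} x" for x :: real
  have cont: "continuous_on {a..b} (\<lambda>x. (cmod (Q (of_real x)))\<^sup>2)"
    by (intro continuous_intros continuous_on_compose2[OF Q]) auto
  have hm: "h \<in> borel_measurable N"
    using borel_measurable_continuous_on_indicator[OF _ cont] by (simp add: h_def[abs_def] mult.commute)
  obtain B where B: "\<And>x. x \<in> {a..b} \<Longrightarrow> (cmod (Q (of_real x)))\<^sup>2 \<le> B"
  proof -
    obtain B where "\<forall>y\<in>(\<lambda>x. (cmod (Q (of_real x)))\<^sup>2) ` {a..b}. norm y \<le> B"
      using compact_imp_bounded[OF compact_continuous_image[OF cont compact_Icc]]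
      unfolding bounded_iff by blast
    then show ?thesis using that[of B] by auto
  qed
  have hint: "integrable N h"
  proof (rule integrable_const_bound[where B = "max B 0"])
    show "AE x in N. norm (h x) \<le> max B 0"
      using B by (auto simp: h_def indicator_def le_max_iff_disj)
  qed (rule hm)
  have le: "(\<integral>x. h x \<partial>N) \<le> 2 * (\<delta> n)\<^sup>2 + 2 * (\<integral>x. (cmod (q n x))\<^sup>2 * indicator {a..b} x \<partial>N)" for n
  proof -
    have "(\<integral>x. h x \<partial>N) \<le> (\<integral>x. 2 * (\<delta> n)\<^sup>2 + 2 * ((cmod (q n x))\<^sup>2 * indicator {a..b} x) \<partial>N)"
    proof (rule Bochner_Integration.integral_mono)
      fix x
      show "h x \<le> 2 * (\<delta> n)\<^sup>2 + 2 * ((cmod (q n x))\<^sup>2 * indicator {a..b} x)"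
      proof (cases "x \<in> {a..b}")
        case True
        have "(cmod (Q (of_real x) - q n x))\<^sup>2 \<le> (\<delta> n)\<^sup>2"
          using unif[OF True] by (intro power_mono) auto
        then show ?thesis
          using cmod_diff_sq_le[of "Q (of_real x)" 0 "q n x"] True by (simp add: h_def)
      qed (simp add: h_def)
    qed (use hint m in simp_all)
    also have "\<dots> = 2 * (\<delta> n)\<^sup>2 + 2 * (\<integral>x. (cmod (q n x))\<^sup>2 * indicator {a..b} x \<partial>N)"
      using m prob_space by (subst Bochner_Integration.integral_add) auto
    finally show ?thesis .
  qed
  have "(\<lambda>n. 2 * (\<delta> n)\<^sup>2 + 2 * (\<integral>x. (cmod (q n x))\<^sup>2 * indicator {a..b} x \<partial>N)) \<longlonglongrightarrow> 2 * 0\<^sup>2 + 2 * 0"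
    by (intro tendsto_intros \<delta> q0)
  then have "(\<integral>x. h x \<partial>N) \<le> 0"
    using LIMSEQ_le_const le by fastforce
  moreover have h_nonneg: "AE x in N. 0 \<le> h x" by (simp add: h_def)
  then have "0 \<le> (\<integral>x. h x \<partial>N)" by (rule integral_nonneg_AE)
  ultimately have "(\<integral>x. h x \<partial>N) = 0" by simp
  then have "AE x in N. h x = 0"
    using integral_nonneg_eq_0_iff_AE[OF hint] h_nonneg by blast
  then show ?thesis by eventually_elim (auto simp: h_def indicator_def)
qed

text \<open>
  If the moments did not determine \<mu>, polynomials that converge in L2 of \<mu> would converge locally
  uniformly near the real axis. Their limit would be holomorphic, take the value 1 at 0, and vanish
  almost everywhere on the interval [a, b], where \<mu> has mass but no atoms.
\<close>

theorem hamburger_determinate_of_zero_approx: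
  assumes \<mu>: "real_distribution \<mu>" "finite_moments \<mu>" and \<nu>: "real_distribution \<nu>" "finite_moments \<nu>"
    and eq: "\<And>n. n \<ge> 1 \<Longrightarrow> (\<integral>x. x ^ n \<partial>\<nu>) = (\<integral>x. x ^ n \<partial>\<mu>)"
    and approx: "\<And>\<epsilon>. \<epsilon> > 0 \<Longrightarrow> \<exists>q :: complex poly.
        integrable \<mu> (\<lambda>x. (cmod (poly q (of_real x) - indicator {0} x))\<^sup>2) \<and>
        (\<integral>x. (cmod (poly q (of_real x) - indicator {0} x))\<^sup>2 \<partial>\<mu>) \<le> \<epsilon> \<and> cmod (poly q 0 - 1) \<le> \<epsilon>"
    and ab: "0 < a" "a \<le> b" and pos: "measure \<mu> {a..b} > 0"
    and nonatomic: "\<And>x. x \<in> {a..b} \<Longrightarrow> measure \<mu> {x} = 0"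
  shows "\<nu> = \<mu>"
proof (rule ccontr)
  assume ne: "\<nu> \<noteq> \<mu>"
  interpret real_distribution \<mu> by fact
  obtain Y where Y: "Y > 0"
    and Ybd: "\<And>R. \<exists>K\<ge>0. \<forall>p w. \<bar>Re w\<bar> \<le> R \<longrightarrow> \<bar>Im w\<bar> \<le> Y \<longrightarrow> cmod (poly p w) \<le> K * poly_L2 \<mu> p"
    using poly_eval_bound_strip[OF \<mu> \<nu> eq ne] by metis
  \<comment> \<open>The box S below has to contain both 0 and the interval [a, b].\<close>
  define R where "R = b + 1"
  obtain K where K0: "K \<ge> 0"
    and K: "\<And>p w. \<bar>Re w\<bar> \<le> R \<Longrightarrow> \<bar>Im w\<bar> \<le> Y \<Longrightarrow> cmod (poly p w) \<le> K * poly_L2 \<mu> p"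
    using Ybd[of R] by blast
  define S where "S = {w. \<bar>Re w\<bar> < R \<and> \<bar>Im w\<bar> < Y}"
  have S_eq: "S = {w. Re w < R} \<inter> {w. Re w > - R} \<inter> {w. Im w < Y} \<inter> {w. Im w > - Y}"
    by (auto simp: S_def)
  have "open S" unfolding S_eq
    by (intro open_Int open_halfspace_Re_lt open_halfspace_Re_gt open_halfspace_Im_lt open_halfspace_Im_gt)
  have "convex S" unfolding S_eq
    by (intro convex_Int convex_halfspace_Re_lt convex_halfspace_Re_gt convex_halfspace_Im_lt convex_halfspace_Im_gt)
  then have "connected S" by (rule convex_connected)
  \<comment> \<open>Any null sequence of positive errors will do.\<close>
  define e where "e n = 1 / real (Suc n)" for n
  have e0: "e \<longlonglongrightarrow> 0" unfolding e_def by (rule LIMSEQ_Suc[OF lim_1_over_n])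
  have epos: "e n > 0" for n by (simp add: e_def)
  define good where "good n q \<longleftrightarrow>
        integrable \<mu> (\<lambda>x. (cmod (poly q (of_real x) - indicator {0} x))\<^sup>2) \<and>
        (\<integral>x. (cmod (poly q (of_real x) - indicator {0} x))\<^sup>2 \<partial>\<mu>) \<le> e n \<and> cmod (poly q 0 - 1) \<le> e n" for n q
  have "\<forall>n. \<exists>q. good n q" using approx[OF epos] unfolding good_def by blast
  from choice[OF this] obtain q where "\<And>n. good n (q n)" by blast
  then have qi: "\<And>n. integrable \<mu> (\<lambda>x. (cmod (poly (q n) (of_real x) - indicator {0} x))\<^sup>2)"
    and q: "\<And>n. (\<integral>x. (cmod (poly (q n) (of_real x) - indicator {0} x))\<^sup>2 \<partial>\<mu>) \<le> e n"
    and q0: "\<And>n. cmod (poly (q n) 0 - 1) \<le> e n"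
    unfolding good_def by blast+
  have L2: "poly_L2 \<mu> (q m - q n) \<le> sqrt (2 * e m + 2 * e n)" for m n
  proof -
    have "(\<integral>x. (cmod (poly (q m - q n) (of_real x)))\<^sup>2 \<partial>\<mu>)
        \<le> (\<integral>x. 2 * (cmod (poly (q m) (of_real x) - indicator {0} x))\<^sup>2 + 2 * (cmod (poly (q n) (of_real x) - indicator {0} x))\<^sup>2 \<partial>\<mu>)"
    proof (rule Bochner_Integration.integral_mono)
      show "integrable \<mu> (\<lambda>x. (cmod (poly (q m - q n) (of_real x)))\<^sup>2)"
        by (rule integrable_cmod_sq_poly[OF \<mu>])
      show "integrable \<mu> (\<lambda>x. 2 * (cmod (poly (q m) (of_real x) - indicator {0} x))\<^sup>2 + 2 * (cmod (poly (q n) (of_real x) - indicator {0} x))\<^sup>2)"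
        by (intro Bochner_Integration.integrable_add integrable_mult_right qi)
      fix x
      show "(cmod (poly (q m - q n) (of_real x)))\<^sup>2 \<le> 2 * (cmod (poly (q m) (of_real x) - indicator {0} x))\<^sup>2 + 2 * (cmod (poly (q n) (of_real x) - indicator {0} x))\<^sup>2"
        using cmod_diff_sq_le[of "poly (q m) (of_real x)" "poly (q n) (of_real x)" "indicator {0} x"]
        by (simp add: norm_minus_commute)
    qed
    also have "\<dots> \<le> 2 * e m + 2 * e n"
      using q[of m] q[of n] qi by simp
    finally show ?thesis unfolding poly_L2_def by simp
  qed
  have diff: "cmod (poly (q m) w - poly (q n) w) \<le> K * sqrt (2 * e m + 2 * e n)" if "w \<in> S" for m n w
  proof -
    have "cmod (poly (q m - q n) w) \<le> K * poly_L2 \<mu> (q m - q n)" using that by (intro K) (auto simp: S_def)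
    also have "\<dots> \<le> K * sqrt (2 * e m + 2 * e n)" by (intro mult_left_mono L2 K0)
    finally show ?thesis by simp
  qed
  have "uniformly_Cauchy_on S (\<lambda>n. poly (q n))"
  proof (rule uniformly_Cauchy_onI')
    fix \<epsilon> :: real assume \<epsilon>: "\<epsilon> > 0"
    have "(\<lambda>n. K * sqrt (2 * e n + 2 * e n)) \<longlonglongrightarrow> K * sqrt (2 * 0 + 2 * 0)"
      by (intro tendsto_intros e0)
    then have "\<forall>\<^sub>F n in sequentially. K * sqrt (2 * e n + 2 * e n) < \<epsilon>"
      using \<epsilon> by (intro order_tendstoD) auto
    then obtain n0 where n0: "K * sqrt (2 * e n0 + 2 * e n0) < \<epsilon>" by (auto simp: eventually_sequentially)
    have "dist (poly (q m) w) (poly (q n) w) < \<epsilon>" if "w \<in> S" "m \<ge> n0" "n > m" for w m n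
    proof -
      have "e m \<le> e n0" "e n \<le> e n0" using that by (simp_all add: e_def frac_le)
      then have "K * sqrt (2 * e m + 2 * e n) \<le> K * sqrt (2 * e n0 + 2 * e n0)"
        by (intro mult_left_mono K0) simp
      then show ?thesis using diff[OF that(1), of m n] n0 by (simp add: dist_norm)
    qed
    then show "\<exists>M. \<forall>x\<in>S. \<forall>m\<ge>M. \<forall>n>m. dist (poly (q m) x) (poly (q n) x) < \<epsilon>" by blast
  qed
  then obtain Q where Q: "uniform_limit S (\<lambda>n. poly (q n)) Q sequentially"
    using Cauchy_uniformly_convergent unfolding uniformly_convergent_on_def by blast
  have Qhol: "Q holomorphic_on S"
  proof (rule holomorphic_uniform_sequence[OF \<open>open S\<close>])
    show "poly (q n) holomorphic_on S" for n by (intro holomorphic_intros)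
    fix w assume "w \<in> S"
    then obtain d where "d > 0" "cball w d \<subseteq> S" using \<open>open S\<close> open_contains_cball by blast
    then show "\<exists>d>0. cball w d \<subseteq> S \<and> uniform_limit (cball w d) (\<lambda>n. poly (q n)) Q sequentially"
      using uniform_limit_on_subset[OF Q] by blast
  qed
  have lim: "(\<lambda>n. poly (q n) w) \<longlonglongrightarrow> Q w" if "w \<in> S" for w
    using tendsto_uniform_limitI[OF Q that] .
  have zS: "0 \<in> S" using Y ab by (simp add: S_def R_def)
  have "(\<lambda>n. poly (q n) 0) \<longlonglongrightarrow> 1"
    by (rule LIM_zero_cancel, rule Lim_null_comparison[OF _ e0]) (use q0 in auto)
  then have Q0: "Q 0 = 1" using LIMSEQ_unique lim[OF zS] by blast
  have ivS: "of_real ` {a..b} \<subseteq> S" using Y ab by (auto simp: S_def R_def)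
  have limdiff: "cmod (Q w - poly (q n) w) \<le> K * sqrt (2 * e n)" if "w \<in> S" for w n
  proof (rule LIMSEQ_le)
    show "(\<lambda>m. cmod (poly (q m) w - poly (q n) w)) \<longlonglongrightarrow> cmod (Q w - poly (q n) w)"
      by (intro tendsto_intros lim that)
    have "(\<lambda>m. K * sqrt (2 * e m + 2 * e n)) \<longlonglongrightarrow> K * sqrt (2 * 0 + 2 * e n)" by (intro tendsto_intros e0)
    then show "(\<lambda>m. K * sqrt (2 * e m + 2 * e n)) \<longlonglongrightarrow> K * sqrt (2 * e n)" by simp
  qed (use diff[OF that] in auto)
  have zero: "AE x in \<mu>. x \<in> {a..b} \<longrightarrow> Q (of_real x) = 0"
  proof (rule AE_zero_of_uniform_limit[OF \<mu>(1) ab(2), where q = "\<lambda>n x. poly (q n) (of_real x)" and \<delta> = "\<lambda>n. K * sqrt (2 * e n)"])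
    show "continuous_on (of_real ` {a..b}) Q"
      using continuous_on_subset[OF holomorphic_on_imp_continuous_on[OF Qhol] ivS] .
    show "(\<lambda>x. poly (q n) (complex_of_real x)) \<in> borel_measurable borel" for n
      by (intro borel_measurable_continuous_onI continuous_intros)
    have i: "integrable \<mu> (\<lambda>x. (cmod (poly (q n) (complex_of_real x)))\<^sup>2 * indicator {a..b} x)" for n
      by (intro integrable_real_mult_indicator integrable_cmod_sq_poly \<mu>) auto
    then show "integrable \<mu> (\<lambda>x. (cmod (poly (q n) (complex_of_real x)))\<^sup>2 * indicator {a..b} x)" for n .
    show "cmod (Q (of_real x) - poly (q n) (of_real x)) \<le> K * sqrt (2 * e n)" if "x \<in> {a..b}" for x n
      using ivS that by (intro limdiff) auto
    have "(\<lambda>n. K * sqrt (2 * e n)) \<longlonglongrightarrow> K * sqrt (2 * 0)" by (intro tendsto_intros e0)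
    then show "(\<lambda>n. K * sqrt (2 * e n)) \<longlonglongrightarrow> 0" by simp
    show "(\<lambda>n. \<integral>x. (cmod (poly (q n) (complex_of_real x)))\<^sup>2 * indicator {a..b} x \<partial>\<mu>) \<longlonglongrightarrow> 0"
    proof (rule tendsto_sandwich[OF _ _ tendsto_const e0])
      have "(\<integral>x. (cmod (poly (q n) (complex_of_real x)))\<^sup>2 * indicator {a..b} x \<partial>\<mu>) \<le> e n" for n
      proof (rule order_trans[OF Bochner_Integration.integral_mono q])
        fix x :: real
        show "(cmod (poly (q n) (complex_of_real x)))\<^sup>2 * indicator {a..b} x
            \<le> (cmod (poly (q n) (complex_of_real x) - indicator {0} x))\<^sup>2"
          using ab by (auto simp: indicator_def)
      qed (use i qi in auto)
      then show "\<forall>\<^sub>F n in sequentially. (\<integral>x. (cmod (poly (q n) (complex_of_real x)))\<^sup>2 * indicator {a..b} x \<partial>\<mu>) \<le> e n"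
        by simp
    qed (auto intro!: Bochner_Integration.integral_nonneg)
  qed
  define T where "T = {x \<in> {a..b}. Q (of_real x) = 0}"
  have "infinite T"
  proof
    assume fin: "finite T"
    have "AE x in \<mu>. x \<notin> {t}" if "t \<in> T" for t
      using nonatomic[of t] that by (subst AE_iff_measurable[of "{t}"]) (auto simp: T_def emeasure_eq_measure)
    then have "AE x in \<mu>. \<forall>t\<in>T. x \<notin> {t}" using fin by (subst AE_finite_all) auto
    with zero have "AE x in \<mu>. x \<notin> {a..b}" by eventually_elim (auto simp: T_def)
    then have "emeasure \<mu> {a..b} = 0" by (subst (asm) AE_iff_measurable[of "{a..b}"]) auto
    then show False using pos by (simp add: emeasure_eq_measure)
  qed
  then have "infinite (complex_of_real ` T)" by (simp add: finite_image_iff inj_on_def)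
  moreover have sub: "complex_of_real ` T \<subseteq> of_real ` {a..b}" by (auto simp: T_def)
  moreover have "compact (complex_of_real ` {a..b})"
    by (intro compact_continuous_image continuous_intros) auto
  ultimately obtain \<xi> where \<xi>: "\<xi> \<in> complex_of_real ` {a..b}" "\<xi> islimpt (complex_of_real ` T)"
    unfolding compact_eq_Bolzano_Weierstrass by blast
  have "Q 0 = 0"
    by (rule analytic_continuation[OF Qhol \<open>open S\<close> \<open>connected S\<close> _ _ \<xi>(2) _ zS])
      (use sub ivS \<xi>(1) in \<open>auto simp: T_def\<close>)
  with Q0 show False by simp
qed

section \<open>Polynomials in the square that approximate the indicator of zero\<close>

lemma poly_even_odd:
  fixes p :: "complex poly"
  obtains q s where "\<And>x. poly p x = poly q (x\<^sup>2) + x * poly s (x\<^sup>2)"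
proof (induction p arbitrary: thesis)
  case 0
  show ?case by (rule 0[of 0 0]) simp
next
  case (pCons a p)
  obtain q s where "\<And>x. poly p x = poly q (x\<^sup>2) + x * poly s (x\<^sup>2)" using pCons.IH by blast
  then have "poly (pCons a p) x = poly (pCons a s) (x\<^sup>2) + x * poly q (x\<^sup>2)" for x
    by (simp add: algebra_simps power2_eq_square)
  then show ?case by (rule pCons.prems)
qed

text \<open>
  The cosine squared at x / k is about 1 - (x / k)^2, so a power of the order k^3 sends it to zero for
  every x \<noteq> 0, whereas it stays 1 at x = 0.
\<close>

lemma cos_power_tendsto_0:
  fixes x :: real
  assumes "x \<noteq> 0"
  shows "(\<lambda>k. cos (1 / real (Suc k) * x) ^ (2 * Suc k ^ 3)) \<longlonglongrightarrow> 0"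
proof -
  have lim: "((\<lambda>k. exp (- (real (Suc k) ^ 3 * (sin (1 / real (Suc k) * \<bar>x\<bar>))\<^sup>2))) \<longlonglongrightarrow> 0)"
    using assms by real_asymp
  have upper: "cos (1 / real (Suc k) * x) ^ (2 * Suc k ^ 3) \<le> exp (- (real (Suc k) ^ 3 * (sin (1 / real (Suc k) * \<bar>x\<bar>))\<^sup>2))" for k
  proof -
    define t where "t = 1 / real (Suc k) * x"
    have t: "(sin (1 / real (Suc k) * \<bar>x\<bar>))\<^sup>2 = (sin t)\<^sup>2" by (cases "x \<ge> 0") (auto simp: t_def)
    have "(cos t)\<^sup>2 \<le> exp (- (sin t)\<^sup>2)" using exp_ge_add_one_self[of "- (sin t)\<^sup>2"] by (simp add: cos_squared_eq)
    then have "((cos t)\<^sup>2) ^ (Suc k ^ 3) \<le> exp (- (sin t)\<^sup>2) ^ (Suc k ^ 3)" by (intro power_mono) auto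
    also have "\<dots> = exp (- (real (Suc k) ^ 3 * (sin t)\<^sup>2))"
      by (simp add: exp_of_nat_mult[symmetric] del: of_nat_Suc)
    finally show ?thesis unfolding t by (simp add: t_def power_mult)
  qed
  have lower: "0 \<le> cos (1 / real (Suc k) * x) ^ (2 * Suc k ^ 3)" for k by (simp add: power_mult)
  show ?thesis
    by (rule tendsto_sandwich[OF always_eventually[OF allI[OF lower]] always_eventually[OF allI[OF upper]] tendsto_const lim])
qed

context carleman_sequence
begin

text \<open>
  The functions cos (x / k)^(2 k^3) tend to the indicator of {0} and are limits of polynomials in the
  weighted norm. Both they and the weight are even, so the odd part of the polynomials can be dropped;
  what remains is a polynomial in x^2. Control in the weighted norm includes the point 0 itself, even
  if it carries no mass.
\<close>

theorem zero_approx_square: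
  assumes \<sigma>: "real_distribution \<sigma>" "finite_moments \<sigma>" and bd: "\<And>n. (\<integral>x. x ^ (2 * n) \<partial>\<sigma>) \<le> (M n)\<^sup>2"
    and \<epsilon>: "\<epsilon> > 0"
  shows "\<exists>q :: complex poly.
      integrable \<sigma> (\<lambda>x. (cmod (poly q (of_real (x\<^sup>2)) - indicator {0} x))\<^sup>2) \<and>
      (\<integral>x. (cmod (poly q (of_real (x\<^sup>2)) - indicator {0} x))\<^sup>2 \<partial>\<sigma>) \<le> \<epsilon> \<and> cmod (poly q 0 - 1) \<le> \<epsilon>"
proof -
  interpret real_distribution \<sigma> by fact
  define u where "u k x = cos (1 / real (Suc k) * x) ^ (2 * Suc k ^ 3)" for k :: nat and x :: real
  define z where "z = (indicator {0} :: real \<Rightarrow> real)"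
  have u01: "0 \<le> u k x" "u k x \<le> 1" for k x
  proof -
    have eq: "u k x = ((cos (1 / real (Suc k) * x))\<^sup>2) ^ (Suc k ^ 3)" by (simp only: u_def power_mult)
    have le1: "(cos (1 / real (Suc k) * x))\<^sup>2 \<le> 1" by (simp only: abs_square_le_1 abs_cos_le_one)
    show "0 \<le> u k x" unfolding eq by (rule zero_le_power[OF zero_le_power2])
    show "u k x \<le> 1" unfolding eq by (rule power_le_one[OF zero_le_power2 le1])
  qed
  have diff1: "(u k x - z x)\<^sup>2 \<le> 1" for k x
    using u01[of k x] by (auto simp: z_def indicator_def abs_square_le_1)
  have um: "u k \<in> borel_measurable borel" for k unfolding u_def[abs_def] by measurable
  have uint: "integrable \<sigma> (\<lambda>x. (u k x - z x)\<^sup>2)" for k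
    by (rule integrable_const_bound[where B = 1]) (use diff1 um in \<open>auto simp: z_def\<close>)
  have "(\<lambda>k. \<integral>x. (u k x - z x)\<^sup>2 \<partial>\<sigma>) \<longlonglongrightarrow> (\<integral>x. 0 \<partial>\<sigma>)"
  proof (rule integral_dominated_convergence[where w = "\<lambda>_. 1"])
    show "AE x in \<sigma>. (\<lambda>k. (u k x - z x)\<^sup>2) \<longlonglongrightarrow> 0"
    proof (rule AE_I2)
      fix x
      have "(\<lambda>k. u k x) \<longlonglongrightarrow> z x"
        using cos_power_tendsto_0[of x] by (cases "x = 0") (auto simp: u_def[abs_def] z_def)
      then have "(\<lambda>k. (u k x - z x)\<^sup>2) \<longlonglongrightarrow> (z x - z x)\<^sup>2" by (intro tendsto_intros)
      then show "(\<lambda>k. (u k x - z x)\<^sup>2) \<longlonglongrightarrow> 0" by simp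
    qed
  qed (use uint diff1 in \<open>auto intro: borel_measurable_integrable\<close>)
  then have "\<forall>\<^sub>F k in sequentially. (\<integral>x. (u k x - z x)\<^sup>2 \<partial>\<sigma>) < \<epsilon> / 4"
    using \<epsilon> by (intro order_tendstoD) auto
  then obtain k where k: "(\<integral>x. (u k x - z x)\<^sup>2 \<partial>\<sigma>) < \<epsilon> / 4" by (auto simp: eventually_sequentially)
  define I where "I = (\<integral>x. W x \<partial>\<sigma>)"
  have Wint: "integrable \<sigma> W" by (rule integrable_W[OF \<sigma> bd])
  have I: "I \<ge> 0" unfolding I_def by (intro integral_nonneg_AE AE_I2 W_nonneg)
  define \<delta> where "\<delta> = min (\<epsilon> / (sqrt (W 0) + 1)) (sqrt (\<epsilon> / (4 * (I + 1))))"
  have \<delta>: "\<delta> > 0" unfolding \<delta>_def using \<epsilon> I W_nonneg[of 0] by (simp add: add_nonneg_pos)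
  have \<delta>1: "\<delta> * sqrt (W 0) \<le> \<epsilon>"
  proof -
    have "\<delta> * sqrt (W 0) \<le> \<epsilon> / (sqrt (W 0) + 1) * (sqrt (W 0) + 1)"
      using \<epsilon> W_nonneg[of 0] by (intro mult_mono) (auto simp: \<delta>_def)
    also have "\<dots> = \<epsilon>" using W_nonneg[of 0] by (simp add: add_nonneg_eq_0_iff)
    finally show ?thesis .
  qed
  have \<delta>2: "\<delta>\<^sup>2 * I \<le> \<epsilon> / 4"
  proof -
    have "\<delta>\<^sup>2 \<le> (sqrt (\<epsilon> / (4 * (I + 1))))\<^sup>2" using \<delta> by (intro power_mono) (auto simp: \<delta>_def)
    then have "\<delta>\<^sup>2 * I \<le> \<epsilon> / (4 * (I + 1)) * I" using I \<epsilon> by (intro mult_right_mono) auto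
    also have "\<dots> \<le> \<epsilon> / 4" using I \<epsilon> by (simp add: field_simps)
    finally show ?thesis .
  qed
  obtain p where p: "\<And>x. cmod (of_real (u k x) - poly p (of_real x)) \<le> \<delta> * sqrt (W x)"
    using weight.cos_power_poly_approx[OF \<delta>, of "1 / real (Suc k)" "2 * Suc k ^ 3" 0]
    unfolding poly_approx_def u_def by (auto simp del: power_Suc of_nat_Suc)
  obtain q s where qs: "\<And>x. poly p x = poly q (x\<^sup>2) + x * poly s (x\<^sup>2)" using poly_even_odd[of p] by blast
  \<comment> \<open>Averaging the approximation over x and -x removes the odd part x * s (x^2).\<close>
  have close: "cmod (of_real (u k x) - poly q (of_real (x\<^sup>2))) \<le> \<delta> * sqrt (W x)" for x
  proof -
    have "u k (- x) = u k x" by (simp add: u_def)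
    then have "of_real (u k x) - poly q (of_real (x\<^sup>2))
       = ((of_real (u k x) - poly p (of_real x)) + (of_real (u k (- x)) - poly p (of_real (- x)))) / 2"
      by (simp add: qs)
    also have "cmod \<dots> \<le> (\<delta> * sqrt (W x) + \<delta> * sqrt (W (- x))) / 2"
      using norm_triangle_ineq[of "of_real (u k x) - poly p (of_real x)" "of_real (u k (- x)) - poly p (of_real (- x))"]
        p[of x] p[of "- x"] by (simp add: norm_divide)
    finally show ?thesis by (simp add: W_minus)
  qed
  define h where "h x = (cmod (poly q (of_real (x\<^sup>2)) - indicator {0} x))\<^sup>2" for x :: real
  have hle: "h x \<le> 2 * (\<delta>\<^sup>2 * W x) + 2 * (u k x - z x)\<^sup>2" for x
  proof -
    have "(cmod (of_real (u k x) - poly q (of_real (x\<^sup>2))))\<^sup>2 \<le> (\<delta> * sqrt (W x))\<^sup>2"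
      by (intro power_mono close) auto
    also have "\<dots> = \<delta>\<^sup>2 * W x" using W_nonneg by (simp add: power_mult_distrib)
    finally have 1: "(cmod (poly q (of_real (x\<^sup>2)) - of_real (u k x)))\<^sup>2 \<le> \<delta>\<^sup>2 * W x"
      by (simp only: norm_minus_commute)
    have "cmod (of_real (u k x) - indicator {0} x) = \<bar>u k x - z x\<bar>"
      unfolding norm_of_real[symmetric, where 'a = complex] by (auto simp: z_def indicator_def)
    then show ?thesis
      using cmod_diff_sq_le[of "poly q (of_real (x\<^sup>2))" "indicator {0} x" "of_real (u k x)"] 1
      by (simp add: h_def)
  qed
  have rint: "integrable \<sigma> (\<lambda>x. 2 * (\<delta>\<^sup>2 * W x) + 2 * (u k x - z x)\<^sup>2)"
    by (intro Bochner_Integration.integrable_add integrable_mult_right Wint uint)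
  have "(\<lambda>x. poly q (complex_of_real (x\<^sup>2))) \<in> borel_measurable borel"
    by (intro borel_measurable_continuous_onI continuous_intros)
  then have hm: "h \<in> borel_measurable \<sigma>" unfolding h_def[abs_def] by simp
  have hint: "integrable \<sigma> h"
    by (rule Bochner_Integration.integrable_bound[OF rint hm])
      (use hle in \<open>auto simp: h_def abs_of_nonneg[OF order_trans[OF _ hle]]\<close>)
  have "(\<integral>x. h x \<partial>\<sigma>) \<le> (\<integral>x. 2 * (\<delta>\<^sup>2 * W x) + 2 * (u k x - z x)\<^sup>2 \<partial>\<sigma>)"
    by (intro Bochner_Integration.integral_mono hint rint hle)
  also have "\<dots> = 2 * (\<delta>\<^sup>2 * I) + 2 * (\<integral>x. (u k x - z x)\<^sup>2 \<partial>\<sigma>)"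
    using Wint uint by (simp add: I_def)
  also have "\<dots> \<le> \<epsilon>" using \<delta>2 k by simp
  finally have hle2: "(\<integral>x. h x \<partial>\<sigma>) \<le> \<epsilon>" .
  have "cmod (poly q 0 - 1) \<le> \<epsilon>"
    using close[of 0] \<delta>1 by (simp add: u_def norm_minus_commute)
  then show ?thesis using hint hle2 unfolding h_def[abs_def] by blast
qed

text \<open>
  Since r increases, M (n + 1) is at most a constant to the power n + 1 times (r n)^(n + 1), so the
  terms of the series dominate a multiple of 1 / r n.
\<close>

lemma carleman_diverges:
  assumes "\<And>n. (e n :: real) > 0" and "\<And>n. e n \<le> (M (Suc n))\<^sup>2"
  shows "(\<Sum>n. ennreal (e n powr (- 1 / real (2 * Suc n)))) = \<infinity>"
proof -
  define c where "c = max C 1"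
  have c: "c \<ge> 1" "C \<le> c" by (auto simp: c_def)
  have lower: "1 / c * (1 / r n) \<le> e n powr (- 1 / real (2 * Suc n))" for n
  proof -
    have "M (Suc n) \<le> c ^ Suc n * (\<Prod>k<Suc n. r n)"
      unfolding M_def
    proof (intro mult_mono prod_mono)
      show "C \<le> c ^ Suc n" using c(2) self_le_power[OF c(1), of "Suc n"] by simp
      show "0 \<le> (\<Prod>k<Suc n. r k)" using r_pos by (intro prod_nonneg) (simp add: less_imp_le)
    qed (use c r_pos in \<open>auto intro!: monoD[OF r_mono] simp: less_imp_le\<close>)
    also have "\<dots> = (c * r n) ^ Suc n" by (simp add: power_mult_distrib)
    finally have "(M (Suc n))\<^sup>2 \<le> ((c * r n) ^ Suc n)\<^sup>2"
      using M_pos[of "Suc n"] by (intro power_mono) auto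
    then have le: "e n \<le> (c * r n) ^ (2 * Suc n)"
      using assms(2)[of n] by (metis mult.commute order_trans power_mult)
    have cr: "c * r n > 0" using c r_pos[of n] by simp
    have "1 / (c * r n) = ((c * r n) ^ (2 * Suc n)) powr (- 1 / real (2 * Suc n))"
    proof -
      have "((c * r n) ^ (2 * Suc n)) powr (- 1 / real (2 * Suc n)) = (c * r n) powr (real (2 * Suc n) * (- 1 / real (2 * Suc n)))"
        by (simp only: powr_powr[symmetric] powr_realpow[OF cr])
      also have "real (2 * Suc n) * (- 1 / real (2 * Suc n)) = - 1" by simp
      finally show ?thesis using cr by (simp add: powr_minus field_simps)
    qed
    also have "\<dots> \<le> e n powr (- 1 / real (2 * Suc n))"
      using assms(1)[of n] le by (intro powr_mono2') auto
    finally show ?thesis using c r_pos[of n] by simp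
  qed
  have "\<not> summable (\<lambda>n. 1 / c * (1 / r n))"
    using not_summable_r summable_cmult_iff[of "1 / c" "\<lambda>n. 1 / r n"] c by simp
  then have "\<not> summable (\<lambda>n. e n powr (- 1 / real (2 * Suc n)))"
    using summable_comparison_test'[of "\<lambda>n. e n powr (- 1 / real (2 * Suc n))" 0 "\<lambda>n. 1 / c * (1 / r n)"]
      lower c r_pos by (auto simp: less_imp_le)
  moreover have "summable (\<lambda>n. e n powr (- 1 / real (2 * Suc n)))"
    if "(\<Sum>n. ennreal (e n powr (- 1 / real (2 * Suc n)))) \<noteq> top"
    by (rule summable_suminf_not_top[OF powr_ge_zero that])
  ultimately show ?thesis unfolding infinity_ennreal_def by blast
qed

end

section \<open>Shifts that contract a density\<close>

text \<open>
  Let I b be the integral over [R, b]. Substituting T on [T R, T b] gives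
  I b \<le> I (T b) \<le> I (T R) + \<rho> * I b with \<rho> < 1. As I b is finite, I b \<le> I (T R) / (1 - \<rho>) for
  every b.
\<close>

lemma nn_integral_contracting_substitution_finite:
  fixes g w T T' :: "real \<Rightarrow> real"
  assumes [measurable]: "g \<in> borel_measurable borel" "w \<in> borel_measurable borel"
    and g0: "\<And>x. g x \<ge> 0" and w0: "\<And>x. w x \<ge> 0"
    and gfin: "(\<integral>\<^sup>+x. ennreal (g x) * indicator {R..} x \<partial>lborel) < \<infinity>"
    and wbd: "\<And>b. \<exists>B. \<forall>x\<in>{R..b}. w x \<le> B"
    and T: "\<And>x. x \<ge> R \<Longrightarrow> (T has_real_derivative T' x) (at x)" "continuous_on {R..} T'"
    and T': "\<And>x. x \<ge> R \<Longrightarrow> 0 \<le> T' x" "\<And>x. x \<ge> R \<Longrightarrow> T' x \<le> L"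
    and Tx: "\<And>x. x \<ge> R \<Longrightarrow> x \<le> T x"
    and wT: "\<And>x. x \<ge> R \<Longrightarrow> w (T x) \<le> \<kappa> * w x" and gT: "\<And>x. x \<ge> R \<Longrightarrow> g (T x) \<le> q * g x"
    and q: "q \<ge> 0" and \<kappa>: "\<kappa> \<ge> 0" and L: "q * \<kappa> * L < 1"
  shows "(\<integral>\<^sup>+x. ennreal (w x * g x) * indicator {R..} x \<partial>lborel) < \<infinity>"
proof -
  define h where "h x = w x * g x" for x
  have hm[measurable]: "h \<in> borel_measurable borel" unfolding h_def[abs_def] by measurable
  have h0: "h x \<ge> 0" for x by (simp add: h_def g0 w0)
  define I where "I b = (\<integral>\<^sup>+x. ennreal (h x) * indicator {R..b} x \<partial>lborel)" for b
  have Ifin: "I b < \<infinity>" for b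
  proof -
    obtain B0 where B0: "\<And>x. x \<in> {R..b} \<Longrightarrow> w x \<le> B0" using wbd[of b] by blast
    define B where "B = max B0 0"
    have B: "\<And>x. x \<in> {R..b} \<Longrightarrow> w x \<le> B" and "B \<ge> 0" using B0 by (auto simp: B_def le_max_iff_disj)
    have "I b \<le> (\<integral>\<^sup>+x. ennreal (B) * (ennreal (g x) * indicator {R..} x) \<partial>lborel)"
      unfolding I_def
    proof (rule nn_integral_mono)
      fix x
      show "ennreal (h x) * indicator {R..b} x \<le> ennreal (B) * (ennreal (g x) * indicator {R..} x)"
      proof (cases "x \<in> {R..b}")
        case True
        have "h x \<le> B * g x" unfolding h_def using B[OF True] g0[of x] by (intro mult_right_mono) auto
        then show ?thesis using True g0[of x]
\<open>B \<ge> 0\<close>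
          by (simp add: ennreal_mult[symmetric] ennreal_leI)
      qed simp
    qed
    also have "\<dots> = ennreal (B) * (\<integral>\<^sup>+x. ennreal (g x) * indicator {R..} x \<partial>lborel)"
      by (rule nn_integral_cmult) measurable
    also have "\<dots> < \<infinity>" using gfin by (simp add: ennreal_mult_less_top)
    finally show ?thesis .
  qed
  define J where "J = I (T R)"
  define \<rho> where "\<rho> = q * \<kappa> * max L 0"
  have \<rho>: "0 \<le> \<rho>" "\<rho> < 1" using q \<kappa> L by (auto simp: \<rho>_def max_def)
  have step: "I b \<le> J + ennreal \<rho> * I b" if b: "b \<ge> R" for b
  proof -
    have "I b \<le> (\<integral>\<^sup>+x. (ennreal (h x) * indicator {R..T R} x + ennreal (h x) * indicator {T R..T b} x) \<partial>lborel)"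
      unfolding I_def using Tx[OF b]
      by (intro nn_integral_mono) (auto simp: indicator_def)
    also have "\<dots> = J + (\<integral>\<^sup>+x. ennreal (h x) * indicator {T R..T b} x \<partial>lborel)"
      unfolding J_def I_def by (rule nn_integral_add) measurable
    also have "(\<integral>\<^sup>+x. ennreal (h x) * indicator {T R..T b} x \<partial>lborel) = (\<integral>\<^sup>+x. ennreal (h x * indicator {T R..T b} x) \<partial>lborel)"
      by (intro nn_integral_cong) (simp add: indicator_def)
    also have "\<dots> = (\<integral>\<^sup>+x. ennreal (h (T x) * T' x * indicator {R..b} x) \<partial>lborel)"
      by (rule nn_integral_substitution)
        (use T T' b in \<open>auto simp: set_borel_measurable_def intro: continuous_on_subset\<close>)
    also have "\<dots> \<le> (\<integral>\<^sup>+x. ennreal \<rho> * (ennreal (h x) * indicator {R..b} x) \<partial>lborel)"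
    proof (rule nn_integral_mono)
      fix x
      show "ennreal (h (T x) * T' x * indicator {R..b} x) \<le> ennreal \<rho> * (ennreal (h x) * indicator {R..b} x)"
      proof (cases "x \<in> {R..b}")
        case True
        then have x: "x \<ge> R" by simp
        have "h (T x) * T' x \<le> (\<kappa> * w x) * (q * g x) * max L 0"
          unfolding h_def using wT[OF x] gT[OF x] T'[OF x] g0 w0 q \<kappa>
          by (intro mult_mono) (auto intro!: mult_nonneg_nonneg)
        also have "\<dots> = \<rho> * h x" by (simp add: \<rho>_def h_def)
        finally show ?thesis using True \<rho> h0[of x] by (simp add: ennreal_mult[symmetric] ennreal_leI)
      qed simp
    qed
    also have "\<dots> = ennreal \<rho> * I b"
      unfolding I_def by (rule nn_integral_cmult) measurable
    finally show ?thesis by (simp add: add_left_mono)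
  qed
  define j where "j = enn2real J"
  have j: "J = ennreal j" "j \<ge> 0" using Ifin[of "T R"] by (auto simp: j_def J_def)
  have Ile: "I b \<le> ennreal (j / (1 - \<rho>))" if b: "b \<ge> R" for b
  proof -
    define i where "i = enn2real (I b)"
    have i: "I b = ennreal i" "i \<ge> 0" using Ifin[of b] by (auto simp: i_def)
    have "ennreal i \<le> ennreal (j + \<rho> * i)"
      using step[OF b] i j \<rho> by (simp add: ennreal_mult ennreal_plus)
    then have "i \<le> j + \<rho> * i" using i j \<rho> by (subst (asm) ennreal_le_iff) auto
    then have "i \<le> j / (1 - \<rho>)" using \<rho> by (simp add: field_simps)
    then show ?thesis unfolding i by (rule ennreal_leI)
  qed
  have "(\<integral>\<^sup>+x. ennreal (h x) * indicator {R..} x \<partial>lborel) = (\<integral>\<^sup>+x. (SUP n. ennreal (h x) * indicator {R..R + real n} x) \<partial>lborel)"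
  proof (rule nn_integral_cong)
    fix x
    obtain n where n: "x \<le> R + real n" using real_arch_simple[of "x - R"] by (auto simp: algebra_simps)
    show "ennreal (h x) * indicator {R..} x = (SUP n. ennreal (h x) * indicator {R..R + real n} x)"
    proof (rule antisym)
      have "ennreal (h x) * indicator {R..} x = ennreal (h x) * indicator {R..R + real n} x"
        using n by (auto simp: indicator_def)
      also have "\<dots> \<le> (SUP n. ennreal (h x) * indicator {R..R + real n} x)" by (rule SUP_upper) simp
      finally show "ennreal (h x) * indicator {R..} x \<le> (SUP n. ennreal (h x) * indicator {R..R + real n} x)" .
      show "(SUP n. ennreal (h x) * indicator {R..R + real n} x) \<le> ennreal (h x) * indicator {R..} x"
        by (rule SUP_least) (auto simp: indicator_def)
    qed
  qed
  also have "\<dots> = (SUP n. I (R + real n))"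
    unfolding I_def
  proof (rule nn_integral_monotone_convergence_SUP)
    show "incseq (\<lambda>n x. ennreal (h x) * indicator {R..R + real n} x)"
      by (auto simp: incseq_def le_fun_def indicator_def)
  qed measurable
  also have "\<dots> \<le> ennreal (j / (1 - \<rho>))" by (rule SUP_least) (simp add: Ile)
  also have "\<dots> < \<infinity>" by simp
  finally show ?thesis by (simp add: h_def)
qed

text \<open>
  The common features of the three shifts that matter for the tail estimate: the derivative tends to
  zero, and \<phi> grows at most like the logarithm. The bound exp (exp 1) makes ln (ln x) \<ge> 1.
\<close>

lemma phi_properties:
  assumes a: "a > 0" and \<alpha>: "\<alpha> \<in> {0..1}" and \<phi>: "\<phi> \<in> {phi1 a \<alpha>, phi2 a \<alpha>, phi3 a \<alpha>}"
  obtains \<phi>' where "continuous_on {exp (exp 1)..} \<phi>'"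
    and "\<And>x. x \<ge> exp (exp 1) \<Longrightarrow> (\<phi> has_real_derivative \<phi>' x) (at x)"
    and "\<And>x. x \<ge> exp (exp 1) \<Longrightarrow> \<bar>\<phi>' x\<bar> \<le> (2 * a + 1) / x"
    and "\<And>x. x \<ge> exp (exp 1) \<Longrightarrow> 0 \<le> \<phi> x \<and> \<phi> x \<le> (a + 1) * ln x"
proof -
  define S where "S = {exp (exp 1) :: real..}"
  have x: "x > 0" "ln x \<ge> exp 1" "ln x > 1" "ln (ln x) \<ge> 1" "x > 1" if "x \<in> S" for x
  proof -
    have "exp (exp 1) \<le> x" using that by (simp add: S_def)
    then show 1: "x > 0" using exp_gt_zero less_le_trans by blast
    show 2: "ln x \<ge> exp 1" using \<open>exp (exp 1) \<le> x\<close> 1 by (simp add: ln_ge_iff)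
    then show 3: "ln x > 1" using exp_gt_one[of "1::real"] by linarith
    have "exp (exp 1) > (1 :: real)" by simp
    then show "x > 1" using \<open>exp (exp 1) \<le> x\<close> by linarith
    show "ln (ln x) \<ge> 1" using 2 3 by (simp add: ln_ge_iff)
  qed
  define D where "D x = a * (\<alpha> * ln x powr (\<alpha> - 1) / x)" for x
  have pl: "ln x powr \<alpha> \<le> ln x" "ln x powr (\<alpha> - 1) \<le> 1" if "x \<in> S" for x
  proof -
    have "x \<noteq> 1" using x(3)[OF that] by auto
    then show "ln x powr \<alpha> \<le> ln x" "ln x powr (\<alpha> - 1) \<le> 1"
      using powr_mono[of \<alpha> 1 "ln x"] powr_mono[of "\<alpha> - 1" 0 "ln x"] x[OF that] \<alpha> by auto
  qed
  have apl: "0 \<le> a * ln x powr \<alpha>" "a * ln x powr \<alpha> \<le> a * ln x" if "x \<in> S" for x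
    using pl(1)[OF that] a by auto
  have D: "((\<lambda>x. a * ln x powr \<alpha>) has_real_derivative D x) (at x)" if "x \<in> S" for x
    unfolding D_def using x[OF that] by (auto intro!: derivative_eq_intros simp: powr_diff field_simps)
  have Dle: "0 \<le> D x" "D x \<le> a / x" if "x \<in> S" for x
  proof -
    show "0 \<le> D x" using x[OF that] a \<alpha> by (simp add: D_def)
    have "\<alpha> * ln x powr (\<alpha> - 1) \<le> 1 * 1" using pl[OF that] \<alpha> by (intro mult_mono) auto
    then show "D x \<le> a / x" using x[OF that] a by (simp add: D_def field_simps)
  qed
  have Dcont: "continuous_on S D" unfolding D_def
    by (intro continuous_intros) (use x in force)+
  have lncont: "continuous_on S ln" "continuous_on S (\<lambda>x. ln (ln x))"
    by (intro continuous_intros; use x in force)+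
  consider "\<phi> = phi1 a \<alpha>" | "\<phi> = phi2 a \<alpha>" | "\<phi> = phi3 a \<alpha>" using \<phi> by blast
  then show ?thesis
  proof cases
    case 1
    show ?thesis
    proof (rule that[of D])
      fix y :: real assume "y \<ge> exp (exp 1)"
      then have y: "y \<in> S" by (simp add: S_def)
      show "(\<phi> has_real_derivative D y) (at y)" using D[OF y] by (simp add: 1 phi1_def[abs_def])
      show "\<bar>D y\<bar> \<le> (2 * a + 1) / y"
      proof -
        have "a / y \<le> (2 * a + 1) / y" using a x[OF y] by (intro divide_right_mono) auto
        then show ?thesis using Dle[OF y] by linarith
      qed
      show "0 \<le> \<phi> y \<and> \<phi> y \<le> (a + 1) * ln y"
        using apl[OF y] x[OF y] by (auto simp: 1 phi1_def distrib_right)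
    qed (use Dcont in \<open>simp add: S_def\<close>)
  next
    case 2
    show ?thesis
    proof (rule that[of "\<lambda>x. D x + 1 / (x * ln x)"])
      show "continuous_on {exp (exp 1)..} (\<lambda>x. D x + 1 / (x * ln x))"
        unfolding S_def[symmetric] by (intro continuous_intros Dcont lncont) (use x in force)
      fix y :: real assume "y \<ge> exp (exp 1)"
      then have y: "y \<in> S" by (simp add: S_def)
      have "((\<lambda>x. ln (ln x)) has_real_derivative 1 / (y * ln y)) (at y)"
        using x[OF y] by (auto intro!: derivative_eq_intros)
      then show "(\<phi> has_real_derivative D y + 1 / (y * ln y)) (at y)"
        using DERIV_add[OF D[OF y]] by (simp add: 2 phi2_def[abs_def])
      have "1 / (y * ln y) \<le> 1 / y" "0 \<le> 1 / (y * ln y)" using x[OF y] by (auto simp: field_simps)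
      then have "\<bar>D y + 1 / (y * ln y)\<bar> \<le> a / y + 1 / y" using Dle[OF y] by linarith
      also have "\<dots> \<le> (2 * a + 1) / y" using a x[OF y] by (simp add: field_simps)
      finally show "\<bar>D y + 1 / (y * ln y)\<bar> \<le> (2 * a + 1) / y" .
      have "ln (ln y) \<le> ln y" using ln_le_minus_one[of "ln y"] x[OF y] by linarith
      then show "0 \<le> \<phi> y \<and> \<phi> y \<le> (a + 1) * ln y"
        unfolding 2 phi2_def distrib_right using apl[OF y] x[OF y] by linarith
    qed
  next
    case 3
    define E where "E x = (D x * ln (ln x) - a * ln x powr \<alpha> * (1 / (x * ln x))) / (ln (ln x) * ln (ln x))" for x
    show ?thesis
    proof (rule that[of E])
      show "continuous_on {exp (exp 1)..} E"
        unfolding S_def[symmetric] E_def by (intro continuous_intros Dcont lncont) (use x in force)+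
      fix y :: real assume "y \<ge> exp (exp 1)"
      then have y: "y \<in> S" by (simp add: S_def)
      have ll: "((\<lambda>x. ln (ln x)) has_real_derivative 1 / (y * ln y)) (at y)"
        using x[OF y] by (auto intro!: derivative_eq_intros)
      show "(\<phi> has_real_derivative E y) (at y)"
        using DERIV_divide[OF D[OF y] ll] x[OF y] by (simp add: 3 phi3_def[abs_def] E_def)
      define l where "l = ln (ln y)"
      have l: "l \<ge> 1" using x[OF y] by (simp add: l_def)
      define s where "s = a * ln y powr \<alpha> * (1 / (y * ln y))"
      have s: "0 \<le> s" "s \<le> a / y"
      proof -
        show "0 \<le> s" using a x[OF y] by (simp add: s_def)
        have "s \<le> a * ln y * (1 / (y * ln y))"
          unfolding s_def using a x[OF y] pl[OF y] by (intro mult_right_mono mult_left_mono) auto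
        then show "s \<le> a / y" using x[OF y] by simp
      qed
      have "E y = D y / l - s / (l * l)" unfolding E_def l_def[symmetric] s_def[symmetric] diff_divide_distrib using l by simp
      moreover have "0 \<le> D y / l" "D y / l \<le> D y / 1"
        using l Dle[OF y] divide_left_mono[of 1 l "D y"] by auto
      moreover have "1 * 1 \<le> l * l" using l by (intro mult_mono) auto
      then have "0 \<le> s / (l * l)" "s / (l * l) \<le> s / 1"
        using s divide_left_mono[of 1 "l * l" s] by auto
      ultimately have "\<bar>E y\<bar> \<le> a / y + a / y" using Dle[OF y] s by linarith
      also have "\<dots> \<le> (2 * a + 1) / y" using a x[OF y] by (simp add: field_simps)
      finally show "\<bar>E y\<bar> \<le> (2 * a + 1) / y" .
      have "\<phi> y \<le> a * ln y powr \<alpha>" "0 \<le> \<phi> y"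
        unfolding 3 phi3_def l_def[symmetric]
        using l apl(1)[OF y] divide_left_mono[of 1 l "a * ln y powr \<alpha>"] by auto
      then show "0 \<le> \<phi> y \<and> \<phi> y \<le> (a + 1) * ln y"
        using apl[OF y] x[OF y] by (auto simp: distrib_right)
    qed
  qed
qed

section \<open>Moments under an exponential tail\<close>

definition log_factorial_prod :: "nat \<Rightarrow> real" where
  "log_factorial_prod n = (\<Prod>k<n. real (Suc k) * ln (real k + 4))"

lemma ln_ge_1: "ln (real k + 4) \<ge> 1" "ln (real k + 3) \<ge> 1"
  using exp_le by (auto simp: ln_ge_iff)

lemma log_factorial_prod_ge_1: "log_factorial_prod n \<ge> 1"
proof -
  have "1 * 1 \<le> real (Suc k) * ln (real k + 4)" for k
    by (intro mult_mono) (use ln_ge_1 in auto)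
  then show ?thesis unfolding log_factorial_prod_def by (intro prod_ge_1) simp
qed

text \<open>
  By induction: passing from n to n + 1 multiplies the n-th power of the logarithm by at most
  (1 + 1 / (n + 3))^n \<le> e.
\<close>

lemma ln_power_le_prod: "ln (real n + 3) ^ n \<le> exp 1 ^ n * (\<Prod>k<n. ln (real k + 4))"
proof (induction n)
  case (Suc n)
  have "ln (real n + 4) \<le> ln (real n + 3) * (1 + 1 / (real n + 3))"
  proof -
    have "ln (real n + 4) = ln (real n + 3) + ln (1 + 1 / (real n + 3))"
    proof -
      have "(real n + 3) * (1 + 1 / (real n + 3)) = real n + 4" by (simp add: field_simps)
      moreover have "0 < 1 + 1 / (real n + 3)" by (simp add: add_pos_pos)
      ultimately show ?thesis using ln_mult_pos[of "real n + 3" "1 + 1 / (real n + 3)"] by simp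
    qed
    also have "ln (1 + 1 / (real n + 3)) \<le> 1 / (real n + 3)" by (rule ln_add_one_self_le_self) simp
    also have "\<dots> \<le> ln (real n + 3) * (1 / (real n + 3))"
      using ln_ge_1(2)[of n] by (simp add: field_simps)
    finally show ?thesis by (simp add: algebra_simps)
  qed
  then have "ln (real n + 4) ^ n \<le> (ln (real n + 3) * (1 + 1 / (real n + 3))) ^ n"
    using ln_ge_1(1)[of n] by (intro power_mono) auto
  also have "\<dots> = ln (real n + 3) ^ n * (1 + 1 / (real n + 3)) ^ n" by (rule power_mult_distrib)
  also have "\<dots> \<le> ln (real n + 3) ^ n * exp 1"
  proof (intro mult_left_mono)
    have "(1 + 1 / (real n + 3)) ^ n \<le> exp (1 / (real n + 3)) ^ n"
      by (intro power_mono) (auto simp: exp_ge_add_one_self)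
    also have "\<dots> = exp (real n / (real n + 3))" by (simp add: exp_of_nat_mult[symmetric])
    also have "\<dots> \<le> exp 1" by (simp add: divide_le_eq)
    finally show "(1 + 1 / (real n + 3)) ^ n \<le> exp 1" .
  qed (use ln_ge_1(2)[of n] in auto)
  finally have "ln (real n + 4) ^ Suc n \<le> ln (real n + 4) * (ln (real n + 3) ^ n * exp 1)"
    using ln_ge_1(1)[of n] by (auto intro: mult_left_mono)
  also have "\<dots> \<le> ln (real n + 4) * ((exp 1 ^ n * (\<Prod>k<n. ln (real k + 4))) * exp 1)"
    using ln_ge_1(1)[of n] Suc by (intro mult_left_mono mult_right_mono) auto
  finally show ?case by (simp add: mult_ac add.commute)
qed simp

text \<open>
  For y \<le> (n + 3)^3 the exponent is at least a multiple of y / ln (n + 3), and a single term of the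
  exponential series suffices. For larger y, y^n = exp (n ln y) with n \<le> y^(1/3), which is negligible
  against exp (c y / ln y).
\<close>

lemma power_le_exp_div_ln:
  fixes c :: real
  assumes c: "c > 0"
  obtains K D where "K \<ge> 1" "D \<ge> 1"
    and "\<And>n y. y \<ge> exp 1 \<Longrightarrow> y ^ n \<le> K * D ^ n * log_factorial_prod n * exp (c * y / ln y)"
proof -
  have "\<forall>\<^sub>F y in at_top. y powr (1/3) * ln y \<le> c * y / ln y" using c by real_asymp
  then obtain Y where Y: "\<And>y. y \<ge> Y \<Longrightarrow> y powr (1/3) * ln y \<le> c * y / ln y"
    by (auto simp: eventually_at_top_linorder)
  define Y1 where "Y1 = max Y 1"
  define K where "K = exp (Y1 * ln Y1)"
  define D where "D = max 1 (3 * exp 1 / c)"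
  have K: "K \<ge> 1" by (simp add: K_def Y1_def)
  have D: "D \<ge> 1" "D \<ge> 3 * exp 1 / c" by (auto simp: D_def)
  show ?thesis
  proof (rule that[OF K D(1)])
    fix n and y :: real assume y: "y \<ge> exp 1"
    have y0: "y > 0" "y \<ge> 1" "y > 1"
      using y exp_gt_zero[of "1::real"] one_less_exp_iff[of "1::real"] by linarith+
    have ly: "ln y \<ge> 1" using y y0 by (simp add: ln_ge_iff)
    have m: "log_factorial_prod n \<ge> 1" by (rule log_factorial_prod_ge_1)
    show "y ^ n \<le> K * D ^ n * log_factorial_prod n * exp (c * y / ln y)"
    proof (cases "y \<le> (real n + 3) ^ 3")
      case True
      define L where "L = ln (real n + 3)"
      have L: "L \<ge> 1" unfolding L_def by (rule ln_ge_1)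
      have "ln y \<le> ln ((real n + 3) ^ 3)" using True y0 by (subst ln_le_cancel_iff) auto
      then have lyL: "ln y \<le> 3 * L" by (simp add: L_def ln_realpow)
      define z where "z = c * y / (3 * L)"
      have z: "z \<ge> 0" "z \<le> c * y / ln y"
        unfolding z_def using c y0 L ly lyL by (auto intro!: divide_left_mono mult_pos_pos)
      have "y ^ n = (3 * L / c) ^ n * z ^ n"
        using c L by (simp add: z_def power_mult_distrib[symmetric])
      also have "\<dots> \<le> (3 * L / c) ^ n * (fact n * exp (c * y / ln y))"
      proof (intro mult_left_mono)
        have "z ^ n \<le> fact n * exp z" using sum_power_div_fact_le_exp[OF z(1), of "{n}"] by (simp add: field_simps)
        also have "\<dots> \<le> fact n * exp (c * y / ln y)" using z by (intro mult_left_mono) auto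
        finally show "z ^ n \<le> fact n * exp (c * y / ln y)" .
      qed (use c L in auto)
      also have "\<dots> = (3 / c) ^ n * (L ^ n * fact n) * exp (c * y / ln y)"
        by (simp add: power_mult_distrib power_divide)
      also have "\<dots> \<le> (3 / c) ^ n * (exp 1 ^ n * log_factorial_prod n) * exp (c * y / ln y)"
      proof (intro mult_left_mono mult_right_mono)
        have "L ^ n * fact n \<le> (exp 1 ^ n * (\<Prod>k<n. ln (real k + 4))) * fact n"
          unfolding L_def by (intro mult_right_mono ln_power_le_prod) auto
        also have "\<dots> = exp 1 ^ n * log_factorial_prod n"
          unfolding log_factorial_prod_def prod.distrib by (simp add: fact_prod_Suc atLeast0LessThan)
        finally show "L ^ n * fact n \<le> exp 1 ^ n * log_factorial_prod n" .
      qed (use c in auto)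
      also have "\<dots> = (3 * exp 1 / c) ^ n * log_factorial_prod n * exp (c * y / ln y)"
        by (simp add: power_mult_distrib power_divide)
      also have "\<dots> \<le> D ^ n * log_factorial_prod n * exp (c * y / ln y)"
        using D c m by (intro mult_right_mono power_mono) auto
      also have "\<dots> \<le> K * (D ^ n * log_factorial_prod n * exp (c * y / ln y))"
        using mult_right_mono[OF K, of "D ^ n * log_factorial_prod n * exp (c * y / ln y)"] D m by simp
      finally show ?thesis by (simp add: mult_ac)
    next
      case False
      have "real n \<le> ((real n + 3) ^ 3) powr (1/3)"
      proof -
        have "((real n + 3) ^ 3) powr (1/3) = ((real n + 3) powr 3) powr (1/3)"
          by (subst powr_numeral) auto
        also have "\<dots> = (real n + 3) powr (3 * (1/3))" by (rule powr_powr)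
        also have "\<dots> = real n + 3" by simp
        finally show ?thesis by simp
      qed
      also have "\<dots> \<le> y powr (1/3)" using False by (intro powr_mono2) auto
      finally have n: "real n \<le> y powr (1/3)" .
      have "y powr (1/3) * ln y \<le> Y1 * ln Y1 + c * y / ln y"
      proof (cases "y \<ge> Y")
        case True
        have "0 \<le> Y1 * ln Y1" by (simp add: Y1_def)
        then show ?thesis using Y[OF True] by simp
      next
        case False
        then have yY: "y \<le> Y1" by (simp add: Y1_def)
        have "y powr (1/3) \<le> y powr 1" using y0 by (intro powr_mono) auto
        then have "y powr (1/3) * ln y \<le> Y1 * ln Y1"
          using yY y0 ly by (intro mult_mono) auto
        moreover have "0 \<le> c * y / ln y" using c y0 ly by simp
        ultimately show ?thesis by simp
      qed
      then have "real n * ln y \<le> Y1 * ln Y1 + c * y / ln y"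
        using mult_right_mono[OF n, of "ln y"] ly by linarith
      then have "exp (real n * ln y) \<le> K * exp (c * y / ln y)"
        by (simp add: K_def exp_add[symmetric])
      then have "y ^ n \<le> K * exp (c * y / ln y) * 1" using y0 by (simp add: exp_of_nat_mult)
      also have "\<dots> \<le> K * exp (c * y / ln y) * (D ^ n * log_factorial_prod n)"
        using K m D mult_mono[of 1 "D ^ n" 1 "log_factorial_prod n"] by (intro mult_left_mono) auto
      finally show ?thesis by (simp add: mult_ac)
    qed
  qed
qed

text \<open>
  Divergence of the sum of 1 / (k ln k), by comparison with the telescoping differences of ln (ln k).
\<close>

lemma carleman_sequence_n_ln:
  assumes C: "C > 0" and D: "D > 0"
  shows "carleman_sequence C (\<lambda>k. D * (real (Suc k) * ln (real k + 4)))"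
proof
  show "C > 0" by fact
  show pos: "0 < D * (real (Suc k) * ln (real k + 4))" for k
    using D ln_ge_1(1)[of k] by (intro mult_pos_pos) auto
  show "mono (\<lambda>k. D * (real (Suc k) * ln (real k + 4)))"
    using D ln_ge_1 by (intro monoI mult_left_mono mult_mono) (auto intro: order_trans[OF zero_le_one])
  show "filterlim (\<lambda>k. D * (real (Suc k) * ln (real k + 4))) at_top sequentially"
    using D by real_asymp
  show "\<not> summable (\<lambda>k. 1 / (D * (real (Suc k) * ln (real k + 4))))"
  proof
    assume "summable (\<lambda>k. 1 / (D * (real (Suc k) * ln (real k + 4))))"
    then have "summable (\<lambda>k. D * (1 / (D * (real (Suc k) * ln (real k + 4)))))" by (rule summable_mult)
    then have s: "summable (\<lambda>k. 1 / (real (Suc k) * ln (real k + 4)))" using D by simp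
    define v where "v k = ln (ln (real k + 4))" for k :: nat
    have "summable (\<lambda>k. v (Suc k) - v k)"
    proof (rule summable_comparison_test'[OF s, of 0])
      fix k :: nat
      define t where "t = real k + 4"
      have t: "t \<ge> 4" "ln t \<ge> 1" using ln_ge_1(1)[of k] by (auto simp: t_def)
      have "0 \<le> v (Suc k) - v k"
        using t by (simp add: v_def t_def)
      have "ln (t + 1) = ln t + ln (1 + 1 / t)"
      proof -
        have "t * (1 + 1 / t) = t + 1" using t by (simp add: field_simps)
        moreover have "0 < t" "0 < 1 + 1 / t" using t by (auto intro!: add_pos_pos)
        ultimately show ?thesis using ln_mult_pos[of t "1 + 1 / t"] by simp
      qed
      also have "ln (1 + 1 / t) \<le> 1 / t" using t by (intro ln_add_one_self_le_self) auto
      finally have "ln (t + 1) \<le> ln t + 1 / t" by simp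
      also have "\<dots> = ln t * (1 + 1 / (t * ln t))"
      proof -
        have "l + 1 / t = l * (1 + 1 / (t * l))" if "l \<noteq> 0" for l using that t by (simp add: field_simps)
        then show ?thesis using t by simp
      qed
      finally have 1: "ln (t + 1) \<le> ln t * (1 + 1 / (t * ln t))" .
      have "ln (ln (t + 1)) \<le> ln (ln t * (1 + 1 / (t * ln t)))"
        using 1 t by (subst ln_le_cancel_iff) (auto intro!: mult_pos_pos add_pos_pos)
      also have "\<dots> = ln (ln t) + ln (1 + 1 / (t * ln t))"
        using t by (intro ln_mult_pos) (auto intro!: add_pos_pos)
      also have "ln (1 + 1 / (t * ln t)) \<le> 1 / (t * ln t)" using t by (intro ln_add_one_self_le_self) auto
      also have "\<dots> \<le> 1 / (real (Suc k) * ln t)"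
        using t by (intro divide_left_mono mult_right_mono mult_pos_pos) (auto simp: t_def)
      finally have "v (Suc k) - v k \<le> 1 / (real (Suc k) * ln (real k + 4))"
        by (simp add: v_def t_def add_ac)
      then show "norm (v (Suc k) - v k) \<le> 1 / (real (Suc k) * ln (real k + 4))"
        using \<open>0 \<le> v (Suc k) - v k\<close> by simp
    qed
    then have "convergent (\<lambda>n. \<Sum>k<n. v (Suc k) - v k)" by (simp add: summable_iff_convergent)
    then have "convergent (\<lambda>n. v n - v 0)" by (simp add: sum_lessThan_telescope)
    then have "Bseq (\<lambda>n. v n - v 0)" by (rule convergent_imp_Bseq)
    moreover have "filterlim (\<lambda>n. v n - v 0) at_top sequentially" unfolding v_def by real_asymp
    then have "filterlim (\<lambda>n. v n - v 0) at_infinity sequentially" by (rule filterlim_at_top_imp_at_infinity)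
    ultimately show False using not_tendsto_and_filterlim_at_infinity \<open>convergent (\<lambda>n. v n - v 0)\<close>
      by (metis convergent_def sequentially_bot)
  qed
qed

text \<open>
  The power bound is used with c / 2, so that its square involves exactly the integrable weight; the
  region |x| < R contributes at most R^(2n).
\<close>

lemma moment_bound_of_exp_tail:
  assumes N: "real_distribution N" "finite_moments N" and c: "c > 0" and R: "R \<ge> exp 1"
    and fin: "(\<integral>\<^sup>+x. ennreal (exp (c * \<bar>x\<bar> / ln \<bar>x\<bar>)) * indicator {x. \<bar>x\<bar> \<ge> R} x \<partial>N) < \<infinity>"
  obtains C r where "carleman_sequence C r" "\<And>n. (\<integral>x. x ^ (2 * n) \<partial>N) \<le> (C * (\<Prod>k<n. r k))\<^sup>2"
proof -
  interpret real_distribution N by fact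
  define w where "w x = exp (c * \<bar>x\<bar> / ln \<bar>x\<bar>) * indicator {x. \<bar>x\<bar> \<ge> R} x" for x
  have wm: "w \<in> borel_measurable N" unfolding w_def[abs_def] by measurable
  have "(\<integral>\<^sup>+x. ennreal (w x) \<partial>N) < \<infinity>"
    using fin by (simp add: w_def ennreal_mult ennreal_indicator)
  then have wint: "integrable N w"
    by (intro integrableI_nonneg wm) (auto simp: w_def)
  define J where "J = (\<integral>x. w x \<partial>N)"
  have J: "J \<ge> 0" unfolding J_def by (intro integral_nonneg_AE) (auto simp: w_def)
  obtain K D where K: "K \<ge> 1" and D: "D \<ge> 1"
    and KD: "\<And>n y. y \<ge> exp 1 \<Longrightarrow> y ^ n \<le> K * D ^ n * log_factorial_prod n * exp (c / 2 * y / ln y)"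
    using power_le_exp_div_ln[of "c / 2"] c by auto
  \<comment> \<open>One geometric rate for both regions, |x| \<ge> R and |x| < R.\<close>
  define E where "E = max D R"
  define C where "C = sqrt (1 + K\<^sup>2 * J)"
  have E: "E \<ge> D" "E \<ge> R" "E \<ge> 1" using D by (auto simp: E_def)
  have C: "C > 0" "C\<^sup>2 = 1 + K\<^sup>2 * J" using J by (auto simp: C_def add_pos_nonneg)
  show ?thesis
  proof (rule that[OF carleman_sequence_n_ln[OF C(1), of E]])
    show "E > 0" using E by simp
    fix n
    define m where "m = log_factorial_prod n"
    have m: "m \<ge> 1" unfolding m_def by (rule log_factorial_prod_ge_1)
    have pw: "x ^ (2 * n) \<le> (E ^ n * m)\<^sup>2 * (1 + K\<^sup>2 * w x)" for x
    proof (cases "\<bar>x\<bar> \<ge> R")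
      case True
      then have "\<bar>x\<bar> ^ n \<le> K * D ^ n * m * exp (c / 2 * \<bar>x\<bar> / ln \<bar>x\<bar>)"
        unfolding m_def using R by (intro KD) simp
      also have "\<dots> \<le> K * E ^ n * m * exp (c / 2 * \<bar>x\<bar> / ln \<bar>x\<bar>)"
        using E D K m by (intro mult_right_mono mult_left_mono power_mono) auto
      finally have "(\<bar>x\<bar> ^ n)\<^sup>2 \<le> (K * E ^ n * m * exp (c / 2 * \<bar>x\<bar> / ln \<bar>x\<bar>))\<^sup>2"
        by (intro power_mono) auto
      also have "\<dots> = (E ^ n * m)\<^sup>2 * (K\<^sup>2 * (exp (c / 2 * \<bar>x\<bar> / ln \<bar>x\<bar>))\<^sup>2)"
        by (simp add: power_mult_distrib)
      also have "(exp (c / 2 * \<bar>x\<bar> / ln \<bar>x\<bar>))\<^sup>2 = w x"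
        using True by (simp add: w_def exp_double[symmetric])
      also have "(E ^ n * m)\<^sup>2 * (K\<^sup>2 * w x) \<le> (E ^ n * m)\<^sup>2 * (1 + K\<^sup>2 * w x)"
        by (intro mult_left_mono) auto
      also have "(\<bar>x\<bar> ^ n)\<^sup>2 = x ^ (2 * n)" by (metis power_abs power_even_eq abs_power2 power2_abs)
      finally show ?thesis .
    next
      case False
      have "\<bar>x\<bar> ^ n \<le> E ^ n" using False E by (intro power_mono) auto
      also have "\<dots> \<le> E ^ n * m" using m E by simp
      finally have "(\<bar>x\<bar> ^ n)\<^sup>2 \<le> (E ^ n * m)\<^sup>2" by (intro power_mono) auto
      also have "(\<bar>x\<bar> ^ n)\<^sup>2 = x ^ (2 * n)" by (metis power_abs power_even_eq abs_power2 power2_abs)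
      finally show ?thesis using False by (simp add: w_def)
    qed
    have "integrable N (\<lambda>x. x ^ (2 * n))"
      using N(2) by (cases "n = 0") (auto simp: finite_moments_def)
    then have "(\<integral>x. x ^ (2 * n) \<partial>N) \<le> (\<integral>x. (E ^ n * m)\<^sup>2 * (1 + K\<^sup>2 * w x) \<partial>N)"
      using wint pw by (intro Bochner_Integration.integral_mono) auto
    also have "\<dots> = (E ^ n * m)\<^sup>2 * (1 + K\<^sup>2 * J)"
      using wint prob_space by (simp add: J_def)
    also have "\<dots> = (C * (E ^ n * m))\<^sup>2" by (simp add: power_mult_distrib C mult_ac)
    also have "E ^ n * m = (\<Prod>k<n. E * (real (Suc k) * ln (real k + 4)))"
      by (simp add: m_def log_factorial_prod_def prod.distrib)
    finally show "(\<integral>x. x ^ (2 * n) \<partial>N) \<le> (C * (\<Prod>k<n. E * (real (Suc k) * ln (real k + 4))))\<^sup>2" .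
  qed
qed

section \<open>Tails of a density with decaying ratios\<close>

lemma nn_integral_has_density_on:
  assumes F: "real_distribution F" and d: "has_density_on F S f" and S: "S \<in> sets borel"
    and h: "h \<in> borel_measurable borel"
  shows "(\<lambda>x. f x * indicator S x) \<in> borel_measurable borel"
    and "(\<integral>\<^sup>+x. h x * indicator S x \<partial>F) = (\<integral>\<^sup>+x. h x * ennreal (f x * indicator S x) \<partial>lborel)"
proof -
  interpret real_distribution F by fact
  have fm: "f \<in> borel_measurable (restrict_space lborel S)"
    and eq: "restrict_space F S = density (restrict_space lborel S) (\<lambda>x. ennreal (f x))"
    using d by (auto simp: has_density_on_def)
  have "(\<lambda>x. indicator S x *\<^sub>R f x) \<in> borel_measurable lborel"
    using fm S by (subst (asm) borel_measurable_restrict_space_iff) auto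
  then show "(\<lambda>x. f x * indicator S x) \<in> borel_measurable borel" by (simp add: mult.commute)
  have hm: "h \<in> borel_measurable (restrict_space lborel S)"
    using h by (intro measurable_restrict_space1) simp
  have "(\<integral>\<^sup>+x. h x * indicator S x \<partial>F) = (\<integral>\<^sup>+x. h x \<partial>restrict_space F S)"
    using S by (subst nn_integral_restrict_space) auto
  also have "\<dots> = (\<integral>\<^sup>+x. ennreal (f x) * h x \<partial>restrict_space lborel S)"
    unfolding eq using fm hm by (intro nn_integral_density) auto
  also have "\<dots> = (\<integral>\<^sup>+x. ennreal (f x) * h x * indicator S x \<partial>lborel)"
    using S by (subst nn_integral_restrict_space) auto
  also have "\<dots> = (\<integral>\<^sup>+x. h x * ennreal (f x * indicator S x) \<partial>lborel)"
    by (intro nn_integral_cong) (auto simp: indicator_def mult.commute)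
  finally show "(\<integral>\<^sup>+x. h x * indicator S x \<partial>F) = (\<integral>\<^sup>+x. h x * ennreal (f x * indicator S x) \<partial>lborel)" .
qed

lemma has_density_on_interval:
  assumes F: "real_distribution F" and d: "has_density_on F S f" and S: "S \<in> sets borel"
    and pos: "\<And>x. x \<in> S \<Longrightarrow> f x > 0"
  shows "a < b \<Longrightarrow> {a..b} \<subseteq> S \<Longrightarrow> measure F {a..b} > 0" and "x \<in> S \<Longrightarrow> measure F {x} = 0"
proof -
  interpret real_distribution F by fact
  define g where "g x = f x * indicator S x" for x
  have gm[measurable]: "g \<in> borel_measurable borel"
    using nn_integral_has_density_on(1)[OF F d S, of "\<lambda>_. 0"] by (simp add: g_def[abs_def])
  have em: "emeasure F A = (\<integral>\<^sup>+x. indicator A x * ennreal (g x) \<partial>lborel)" if "A \<subseteq> S" "A \<in> sets borel" for A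
  proof -
    have "emeasure F A = (\<integral>\<^sup>+x. indicator A x \<partial>F)" using that by simp
    also have "\<dots> = (\<integral>\<^sup>+x. indicator A x * indicator S x \<partial>F)"
      using that(1) by (intro nn_integral_cong) (auto simp: indicator_def)
    also have "\<dots> = (\<integral>\<^sup>+x. indicator A x * ennreal (g x) \<partial>lborel)"
      unfolding g_def using that by (intro nn_integral_has_density_on(2)[OF F d S]) auto
    finally show ?thesis .
  qed
  show "measure F {a..b} > 0" if ab: "a < b" "{a..b} \<subseteq> S"
  proof (rule ccontr)
    assume "\<not> ?thesis"
    then have "emeasure F {a..b} = 0" using measure_nonneg[of F "{a..b}"] by (simp add: emeasure_eq_measure)
    then have "(\<integral>\<^sup>+x. indicator {a..b} x * ennreal (g x) \<partial>lborel) = 0" using em[OF ab(2)] by simp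
    then have "AE x in lborel. indicator {a..b} x * ennreal (g x) = 0"
      by (subst (asm) nn_integral_0_iff_AE) auto
    then have "AE x in lborel. x \<notin> {a..b}"
    proof eventually_elim
      case (elim x)
      show ?case
      proof
        assume x: "x \<in> {a..b}"
        then have "x \<in> S" using ab by blast
        then show False using elim x pos[of x] by (simp add: g_def)
      qed
    qed
    then have "emeasure lborel {a..b} = 0" by (subst (asm) AE_iff_measurable[of "{a..b}"]) auto
    then show False using ab by simp
  qed
  show "measure F {x} = 0" if x: "x \<in> S"
  proof -
    have "AE y in lborel. indicator {x} y * ennreal (g y) = 0"
      using AE_lborel_singleton[of x] by eventually_elim simp
    then have "(\<integral>\<^sup>+y. indicator {x} y * ennreal (g y) \<partial>lborel) = 0"
      by (subst nn_integral_0_iff_AE) auto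
    then show ?thesis using em[of "{x}"] x by (simp add: emeasure_eq_measure)
  qed
qed

lemma nn_integral_lborel_uminus:
  fixes h :: "real \<Rightarrow> ennreal"
  assumes "h \<in> borel_measurable borel"
  shows "(\<integral>\<^sup>+x. h (- x) \<partial>lborel) = (\<integral>\<^sup>+x. h x \<partial>lborel)"
  using nn_integral_real_affine[OF assms, of "-1" 0] by simp

text \<open>
  Each side of the tail satisfies the contraction estimate with the shift T x = x + \<phi> x. Passing from x
  to T x costs a factor T' \<le> 1 / s and a growth of the weight exp (c x / ln x) by at most
  exp (c (a + 1)) = 1 / s, where s is the cube root of q; the total is q / s^2 = s < 1.
\<close>

lemma exp_tail_of_density_ratio:
  assumes F: "real_distribution F" and x0: "x\<^sub>0 > 0"
    and d: "has_density_on F (UNIV - {-x\<^sub>0<..<x\<^sub>0}) f"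
    and pos: "\<And>x. x \<in> UNIV - {-x\<^sub>0<..<x\<^sub>0} \<Longrightarrow> f x > 0"
    and a: "a > 0" and \<alpha>: "\<alpha> \<in> {0..1}" and \<phi>: "\<phi> \<in> {phi1 a \<alpha>, phi2 a \<alpha>, phi3 a \<alpha>}"
    and lim: "Limsup at_infinity (\<lambda>x::real. ereal (f (x + sign x * \<phi> \<bar>x\<bar>) / f x)) < 1"
  obtains c R where "c > 0" "R \<ge> exp 1"
    "(\<integral>\<^sup>+x. ennreal (exp (c * \<bar>x\<bar> / ln \<bar>x\<bar>)) * indicator {x. \<bar>x\<bar> \<ge> R} x \<partial>F) < \<infinity>"
proof -
  interpret real_distribution F by fact
  define S where "S = UNIV - {-x\<^sub>0<..<x\<^sub>0}"
  have Sb: "S \<in> sets borel" by (simp add: S_def)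
  have S_iff: "x \<in> S \<longleftrightarrow> \<bar>x\<bar> \<ge> x\<^sub>0" for x by (auto simp: S_def)
  define g where "g x = f x * indicator S x" for x
  have gm[measurable]: "g \<in> borel_measurable borel"
    using nn_integral_has_density_on(1)[OF F d, of "\<lambda>_. 0"] by (simp add: g_def[abs_def] S_def)
  have trans: "(\<integral>\<^sup>+x. h x * indicator S x \<partial>F) = (\<integral>\<^sup>+x. h x * ennreal (g x) \<partial>lborel)"
    if "h \<in> borel_measurable borel" for h
    unfolding g_def S_def using that by (intro nn_integral_has_density_on(2)[OF F d]) auto
  have g0: "g x \<ge> 0" for x using pos[of x] by (auto simp: g_def S_def indicator_def)
  have gtotal: "(\<integral>\<^sup>+x. ennreal (g x) \<partial>lborel) < \<infinity>"
  proof -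
    have "(\<integral>\<^sup>+x. ennreal (g x) \<partial>lborel) = (\<integral>\<^sup>+x. 1 * indicator S x \<partial>F)" using trans[of "\<lambda>_. 1"] by simp
    also have "\<dots> = emeasure F S" using Sb by simp
    also have "\<dots> < \<infinity>" by (simp add: emeasure_eq_measure)
    finally show ?thesis .
  qed

  obtain q0 where q0: "Limsup at_infinity (\<lambda>x::real. ereal (f (x + sign x * \<phi> \<bar>x\<bar>) / f x)) < ereal q0" "ereal q0 < 1"
    using ereal_dense2[OF lim] by blast
  \<comment> \<open>The maximum ensures q > 0, so that its cube root can be divided by.\<close>
  define q where "q = max q0 (1/2)"
  have q: "0 < q" "q < 1" "q0 \<le> q" using q0(2) by (auto simp: q_def)
  obtain b where b: "\<And>x. \<bar>x\<bar> \<ge> b \<Longrightarrow> f (x + sign x * \<phi> \<bar>x\<bar>) / f x < q"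
    using Limsup_lessD[OF q0(1)] q(3) unfolding eventually_at_infinity by force
  define s where "s = root 3 q"
  have s: "0 < s" "s < 1" "s ^ 3 = q" using q by (auto simp: s_def)
  define c where "c = ln (1 / s) / (a + 1)"
  have c: "c > 0" "exp (c * (a + 1)) = 1 / s" using s a by (auto simp: c_def)
  obtain \<phi>' where \<phi>'c: "continuous_on {exp (exp 1)..} \<phi>'"
    and \<phi>'d: "\<And>x. x \<ge> exp (exp 1) \<Longrightarrow> (\<phi> has_real_derivative \<phi>' x) (at x)"
    and \<phi>'b: "\<And>x. x \<ge> exp (exp 1) \<Longrightarrow> \<bar>\<phi>' x\<bar> \<le> (2 * a + 1) / x"
    and \<phi>b: "\<And>x. x \<ge> exp (exp 1) \<Longrightarrow> 0 \<le> \<phi> x \<and> \<phi> x \<le> (a + 1) * ln x"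
    using phi_properties[OF a \<alpha> \<phi>] by blast
  \<comment> \<open>The derivative of T stays in [1 - \<delta>, 1 + \<delta>], hence between 0 and 1 / s.\<close>
  define \<delta> where "\<delta> = min 1 (1 / s - 1)"
  have \<delta>: "\<delta> > 0" "\<delta> \<le> 1" "1 + \<delta> \<le> 1 / s" using s by (auto simp: \<delta>_def)
  define R where "R = max (max b x\<^sub>0) (max (exp (exp 1)) ((2 * a + 1) / \<delta>))"
  have R: "R \<ge> b" "R \<ge> x\<^sub>0" "R \<ge> exp (exp 1)" "R \<ge> (2 * a + 1) / \<delta>" by (auto simp: R_def)
  have Re: "R \<ge> exp 1" using R(3) exp_ge_add_one_self[of "exp 1 :: real"] exp_ge_add_one_self[of "1 :: real"] by linarith
  have xR: "x > 0" "ln x \<ge> 1" "\<bar>\<phi>' x\<bar> \<le> \<delta>" "x \<ge> exp (exp 1)" "x > 1" if "x \<ge> R" for x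
  proof -
    show 1: "x \<ge> exp (exp 1)" using that R by simp
    have "x \<ge> exp 1" using that Re by simp
    then show 2: "x > 0" using exp_gt_zero[of "1::real"] by linarith
    have "exp 1 > (1 :: real)" by simp
    then show "x > 1" using \<open>x \<ge> exp 1\<close> by linarith
    from 2 show "ln x \<ge> 1" using \<open>x \<ge> exp 1\<close> by (simp add: ln_ge_iff)
    have "(2 * a + 1) / \<delta> \<le> x" using that R(4) by simp
    then have "(2 * a + 1) / x \<le> \<delta>" using \<delta>(1) 2 by (simp add: field_simps)
    then show "\<bar>\<phi>' x\<bar> \<le> \<delta>" using \<phi>'b[OF 1] by simp
  qed
  define w where "w x = exp (c * x / ln x)" for x
  have wm[measurable]: "w \<in> borel_measurable borel" unfolding w_def[abs_def] by measurable
  define T where "T x = x + \<phi> x" for x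
  have side: "(\<integral>\<^sup>+x. ennreal (w x * k x) * indicator {R..} x \<partial>lborel) < \<infinity>"
    if km: "k \<in> borel_measurable borel" and k0: "\<And>x. k x \<ge> 0"
      and kfin: "(\<integral>\<^sup>+x. ennreal (k x) \<partial>lborel) < \<infinity>" and kT: "\<And>x. x \<ge> R \<Longrightarrow> k (T x) \<le> q * k x" for k
  proof (rule nn_integral_contracting_substitution_finite[where T = T and T' = "\<lambda>x. 1 + \<phi>' x" and L = "1 / s" and \<kappa> = "1 / s" and q = q])
    show "(\<integral>\<^sup>+x. ennreal (k x) * indicator {R..} x \<partial>lborel) < \<infinity>"
      by (rule le_less_trans[OF nn_integral_mono kfin]) (auto simp: indicator_def)
    show "\<exists>B. \<forall>x\<in>{R..b'}. w x \<le> B" for b'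
    proof (intro exI ballI)
      fix x assume x: "x \<in> {R..b'}"
      then have "c * x / ln x \<le> c * x / 1" using xR[of x] c by (intro divide_left_mono) auto
      also have "\<dots> \<le> c * b'" using x c by simp
      finally show "w x \<le> exp (c * b')" by (simp add: w_def)
    qed
    show "continuous_on {R..} (\<lambda>x. 1 + \<phi>' x)"
      by (intro continuous_intros continuous_on_subset[OF \<phi>'c]) (use R in auto)
    fix x assume x: "x \<ge> R"
    show "(T has_real_derivative 1 + \<phi>' x) (at x)"
      unfolding T_def[abs_def] using \<phi>'d[OF xR(4)[OF x]] by (auto intro!: derivative_eq_intros)
    show "0 \<le> 1 + \<phi>' x" "1 + \<phi>' x \<le> 1 / s" using xR(3)[OF x] \<delta> by linarith+
    show Tx: "x \<le> T x" using \<phi>b[OF xR(4)[OF x]] by (simp add: T_def)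
    have "T x / ln (T x) \<le> T x / ln x"
      using Tx xR[OF x] by (intro divide_left_mono) (auto intro!: mult_pos_pos)
    also have "\<dots> = x / ln x + \<phi> x / ln x" by (simp add: T_def add_divide_distrib)
    also have "\<dots> \<le> x / ln x + (a + 1)" using \<phi>b[OF xR(4)[OF x]] xR[OF x] by (simp add: divide_le_eq)
    finally have "c * (T x / ln (T x)) \<le> c * (x / ln x + (a + 1))" using c by (intro mult_left_mono) auto
    then have "w (T x) \<le> exp (c * (x / ln x + (a + 1)))" by (simp add: w_def)
    also have "\<dots> = 1 / s * w x" unfolding c(2)[symmetric] by (simp add: w_def exp_add[symmetric] algebra_simps)
    finally show "w (T x) \<le> 1 / s * w x" .
    show "k (T x) \<le> q * k x" by (rule kT[OF x])
  next
    have "q * (1 / s) * (1 / s) = s" using s by (simp add: field_simps power3_eq_cube flip: s(3))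
    then show "q * (1 / s) * (1 / s) < 1" using s by simp
  qed (use km k0 wm q s in \<open>auto simp: w_def\<close>)

  have ratio: "f (x + sign x * \<phi> \<bar>x\<bar>) \<le> q * f x" if "\<bar>x\<bar> \<ge> R" for x
  proof -
    have "f x > 0" using pos[of x] S_iff[of x] that R by (simp add: S_def)
    then show ?thesis using b[of x] that R by (simp add: divide_less_eq mult.commute less_imp_le)
  qed
  have gT: "g (T x) \<le> q * g x" "g (- T x) \<le> q * g (- x)" if x: "x \<ge> R" for x
  proof -
    have "x > 0" "x \<in> S" "- x \<in> S" using xR[OF x] x R by (auto simp: S_iff)
    moreover have "T x \<in> S" "- T x \<in> S" using \<phi>b[OF xR(4)[OF x]] x x0 R by (auto simp: S_iff T_def)
    ultimately show "g (T x) \<le> q * g x" "g (- T x) \<le> q * g (- x)"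
      using ratio[of x] ratio[of "- x"] x by (auto simp: g_def T_def sign_def algebra_simps)
  qed
  have right: "(\<integral>\<^sup>+x. ennreal (w x * g x) * indicator {R..} x \<partial>lborel) < \<infinity>"
    by (rule side) (use g0 gtotal gT in auto)
  have left: "(\<integral>\<^sup>+x. ennreal (w x * g (- x)) * indicator {R..} x \<partial>lborel) < \<infinity>"
    by (rule side) (use g0 gtotal gT nn_integral_lborel_uminus[of "\<lambda>x. ennreal (g x)"] in auto)
  define h where "h x = ennreal (exp (c * \<bar>x\<bar> / ln \<bar>x\<bar>)) * indicator {x. \<bar>x\<bar> \<ge> R} x" for x
  have hm[measurable]: "h \<in> borel_measurable borel" unfolding h_def[abs_def] by measurable
  have "(\<integral>\<^sup>+x. h x \<partial>F) = (\<integral>\<^sup>+x. h x * indicator S x \<partial>F)"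
    using R by (intro nn_integral_cong) (auto simp: h_def indicator_def S_iff)
  also have "\<dots> = (\<integral>\<^sup>+x. h x * ennreal (g x) \<partial>lborel)" by (rule trans[OF hm])
  also have "\<dots> \<le> (\<integral>\<^sup>+x. ennreal (w x * g x) * indicator {R..} x + ennreal (w (- x) * g x) * indicator {R..} (- x) \<partial>lborel)"
  proof (rule nn_integral_mono)
    fix x
    have "h x * ennreal (g x) = ennreal (w \<bar>x\<bar> * g x) * indicator {R..} \<bar>x\<bar>"
      using g0[of x] by (simp add: h_def w_def ennreal_mult indicator_def)
    then show "h x * ennreal (g x) \<le> ennreal (w x * g x) * indicator {R..} x + ennreal (w (- x) * g x) * indicator {R..} (- x)"
      by (cases "x \<ge> 0") auto
  qed
  also have "\<dots> = (\<integral>\<^sup>+x. ennreal (w x * g x) * indicator {R..} x \<partial>lborel) + (\<integral>\<^sup>+x. ennreal (w (- x) * g x) * indicator {R..} (- x) \<partial>lborel)"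
    by (rule nn_integral_add) measurable
  also have "(\<integral>\<^sup>+x. ennreal (w (- x) * g x) * indicator {R..} (- x) \<partial>lborel) = (\<integral>\<^sup>+x. ennreal (w x * g (- x)) * indicator {R..} x \<partial>lborel)"
    using nn_integral_lborel_uminus[of "\<lambda>x. ennreal (w x * g (- x)) * indicator {R..} x"] by simp
  finally have "(\<integral>\<^sup>+x. h x \<partial>F) < \<infinity>" using right left by (auto simp: le_less_trans)
  then show ?thesis using that[OF c(1) Re] unfolding h_def by blast
qed

section \<open>Determinacy of the square and the corollary\<close>

lemma m_det_on_half_lineI:
  assumes "m_det_on UNIV \<mu>" "measure \<mu> {0..} = 1"
  shows "m_det_on {0..} \<mu>"
proof -
  have "distribution_on UNIV \<nu>" if "distribution_on {0..} \<nu>" for \<nu>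
  proof -
    interpret real_distribution \<nu> using that by (simp add: distribution_on_def)
    show ?thesis using prob_space by (simp add: distribution_on_def real_distribution_axioms)
  qed
  then show ?thesis using assms unfolding m_det_on_def by (auto simp: distribution_on_def)
qed

lemma (in real_distribution) m_det_on_UNIV_I:
  assumes "finite_moments M"
    and "\<And>\<nu>. real_distribution \<nu> \<Longrightarrow> finite_moments \<nu> \<Longrightarrow>
      (\<And>n. n \<ge> 1 \<Longrightarrow> (\<integral>x. x ^ n \<partial>\<nu>) = (\<integral>x. x ^ n \<partial>M)) \<Longrightarrow> \<nu> = M"
  shows "m_det_on UNIV M"
  unfolding m_det_on_def distribution_on_def
  using assms prob_space real_distribution_axioms by auto

context carleman_sequence
begin

lemma m_det_of_moment_bound:
  assumes \<mu>: "real_distribution \<mu>" "finite_moments \<mu>" and bd: "\<And>n. (\<integral>x. x ^ (2 * n) \<partial>\<mu>) \<le> (M n)\<^sup>2"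
  shows "m_det_on UNIV \<mu>"
  by (rule real_distribution.m_det_on_UNIV_I[OF \<mu>]) (rule determinate[OF \<mu> _ _ _ bd])

text \<open>
  The approximation by polynomials in x^2 under \<sigma> is an approximation by polynomials under the
  distribution of the square; both square roots of a point away from 0 have mass zero.
\<close>

lemma m_det_square:
  assumes \<sigma>: "real_distribution \<sigma>" "finite_moments \<sigma>" and bd: "\<And>n. (\<integral>x. x ^ (2 * n) \<partial>\<sigma>) \<le> (M n)\<^sup>2"
    and ab: "0 < a" "a \<le> b" and pos: "measure \<sigma> {a..b} > 0"
    and nonatomic: "\<And>x. \<bar>x\<bar> \<ge> a \<Longrightarrow> measure \<sigma> {x} = 0"
  shows "m_det_on UNIV (distr \<sigma> borel (\<lambda>x. x\<^sup>2))"
proof -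
  interpret s: real_distribution \<sigma> by fact
  define \<mu> where "\<mu> = distr \<sigma> borel (\<lambda>x. x\<^sup>2)"
  have sq[measurable]: "(\<lambda>x::real. x\<^sup>2) \<in> borel_measurable \<sigma>" by simp
  have \<mu>: "real_distribution \<mu>" unfolding \<mu>_def by (rule s.real_distribution_distr) simp
  interpret m: real_distribution \<mu> by fact
  have fin: "finite_moments \<mu>"
    unfolding finite_moments_def
  proof (intro allI impI)
    fix n :: nat assume "n \<ge> 1"
    then have "integrable \<sigma> (\<lambda>x. x ^ (2 * n))" using \<sigma>(2) by (simp add: finite_moments_def)
    then show "integrable \<mu> (\<lambda>x. x ^ n)"
      unfolding \<mu>_def by (subst integrable_distr_eq) (auto simp: power_mult)
  qed
  show ?thesis
    unfolding \<mu>_def[symmetric]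
  proof (rule m.m_det_on_UNIV_I[OF fin], rule hamburger_determinate_of_zero_approx[OF \<mu> fin])
    show "0 < a\<^sup>2" "a\<^sup>2 \<le> b\<^sup>2" using ab by (auto intro: power_mono)
    fix \<epsilon> :: real assume "\<epsilon> > 0"
    then obtain q :: "complex poly" where q: "integrable \<sigma> (\<lambda>x. (cmod (poly q (of_real (x\<^sup>2)) - indicator {0} x))\<^sup>2)"
      "(\<integral>x. (cmod (poly q (of_real (x\<^sup>2)) - indicator {0} x))\<^sup>2 \<partial>\<sigma>) \<le> \<epsilon>" "cmod (poly q 0 - 1) \<le> \<epsilon>"
      using zero_approx_square[OF \<sigma> bd] by blast
    define h where "h y = (cmod (poly q (of_real y) - indicator {0} y))\<^sup>2" for y :: real
    have "(\<lambda>x. poly q (complex_of_real x)) \<in> borel_measurable borel"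
      by (intro borel_measurable_continuous_onI continuous_intros)
    then have hm: "h \<in> borel_measurable borel" unfolding h_def[abs_def] by measurable
    have hsq: "h (x\<^sup>2) = (cmod (poly q (of_real (x\<^sup>2)) - indicator {0} x))\<^sup>2" for x
      by (simp add: h_def indicator_def)
    have "integrable \<mu> h" "(\<integral>y. h y \<partial>\<mu>) \<le> \<epsilon>"
      unfolding \<mu>_def using q hm by (simp_all add: integrable_distr_eq integral_distr hsq)
    then show "\<exists>q :: complex poly.
        integrable \<mu> (\<lambda>x. (cmod (poly q (of_real x) - indicator {0} x))\<^sup>2) \<and>
        (\<integral>x. (cmod (poly q (of_real x) - indicator {0} x))\<^sup>2 \<partial>\<mu>) \<le> \<epsilon> \<and> cmod (poly q 0 - 1) \<le> \<epsilon>"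
      using q(3) unfolding h_def[abs_def] by blast
  next
    have "measure \<sigma> {a..b} \<le> measure \<sigma> ((\<lambda>x. x\<^sup>2) -` {a\<^sup>2..b\<^sup>2} \<inter> space \<sigma>)"
      using ab by (intro s.finite_measure_mono measurable_sets[OF sq]) (auto intro: power_mono)
    also have "\<dots> = measure \<mu> {a\<^sup>2..b\<^sup>2}" unfolding \<mu>_def by (subst measure_distr) auto
    finally show "measure \<mu> {a\<^sup>2..b\<^sup>2} > 0" using pos by simp
    fix y assume y: "y \<in> {a\<^sup>2..b\<^sup>2}"
    then have sy: "sqrt y \<ge> a" using ab by (intro real_le_rsqrt) auto
    have y0: "y \<ge> 0" using y ab by (auto intro: order_trans[OF zero_le_power2])
    have "measure \<mu> {y} = measure \<sigma> ((\<lambda>x. x\<^sup>2) -` {y} \<inter> space \<sigma>)"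
      unfolding \<mu>_def by (subst measure_distr) auto
    also have "\<dots> \<le> measure \<sigma> ({sqrt y} \<union> {- sqrt y})"
    proof (rule s.finite_measure_mono)
      show "(\<lambda>x. x\<^sup>2) -` {y} \<inter> space \<sigma> \<subseteq> {sqrt y} \<union> {- sqrt y}"
        by (auto simp: real_sqrt_abs)
    qed simp
    also have "\<dots> \<le> measure \<sigma> {sqrt y} + measure \<sigma> {- sqrt y}"
      by (rule measure_Un_le) auto
    also have "\<dots> = 0" using nonatomic[of "sqrt y"] nonatomic[of "- sqrt y"] sy y0 by simp
    finally show "measure \<mu> {y} = 0" using measure_nonneg[of \<mu> "{y}"] by linarith
  qed
qed

end

theorem corollary1:
  fixes M :: "'a measure" and X :: "'a \<Rightarrow> real" and F :: "real measure"
    and f \<phi> :: "real \<Rightarrow> real" and x\<^sub>0 a \<alpha> :: real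
  assumes "prob_space M"
    and "X \<in> borel_measurable M"
    and "distr M borel X = F"
    and "\<And>n::nat. n \<ge> 1 \<Longrightarrow> integrable M (\<lambda>\<omega>. X \<omega> ^ n)"
    and "x\<^sub>0 > exp 1"
    and "has_density_on F (UNIV - {-x\<^sub>0<..<x\<^sub>0}) f"
    and "\<And>x. x \<in> UNIV - {-x\<^sub>0<..<x\<^sub>0} \<Longrightarrow> f x > 0"
    and "a > 0"
    and "\<alpha> \<in> {0..1}"
    and "\<phi> \<in> {phi1 a \<alpha>, phi2 a \<alpha>, phi3 a \<alpha>}"
    and "Limsup at_infinity (\<lambda>x::real. ereal (f (x + sign x * \<phi> \<bar>x\<bar>) / f x)) < 1"
  shows "(\<Sum>n. ennreal ((\<integral>\<omega>. X \<omega> ^ (2 * Suc n) \<partial>M) powr (- 1 / real (2 * Suc n)))) = \<infinity>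
    \<and> m_det_on UNIV (distr M borel X)
    \<and> m_det_on UNIV (distr M borel (\<lambda>\<omega>. (X \<omega>)\<^sup>2))
    \<and> m_det_on {0..} (distr M borel (\<lambda>\<omega>. (X \<omega>)\<^sup>2))
    \<and> m_det_on UNIV (distr M borel (\<lambda>\<omega>. \<bar>X \<omega>\<bar>))
    \<and> m_det_on {0..} (distr M borel (\<lambda>\<omega>. \<bar>X \<omega>\<bar>))"
proof -
  interpret prob_space M by fact
  note X[measurable] = assms(2)
  have F: "real_distribution F" unfolding assms(3)[symmetric] by (rule real_distribution_distr[OF X])
  interpret F: real_distribution F by fact
  have Fint: "(\<integral>x. x ^ n \<partial>F) = (\<integral>\<omega>. X \<omega> ^ n \<partial>M)" for n
    unfolding assms(3)[symmetric] by (subst integral_distr) auto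
  have Ffin: "finite_moments F"
    unfolding finite_moments_def assms(3)[symmetric] using assms(4) by (auto simp: integrable_distr_eq)
  have x0: "x\<^sub>0 > 0" using assms(5) exp_gt_zero[of "1::real"] by linarith
  define S where "S = UNIV - {-x\<^sub>0<..<x\<^sub>0}"
  have dens: "has_density_on F S f" "S \<in> sets borel" "\<And>x. x \<in> S \<Longrightarrow> f x > 0"
    using assms(6,7) by (auto simp: S_def)
  have pos: "measure F {x\<^sub>0..x\<^sub>0 + 1} > 0"
    by (rule has_density_on_interval(1)[OF F dens]) (auto simp: S_def)
  have nonatomic: "measure F {x} = 0" if "\<bar>x\<bar> \<ge> x\<^sub>0" for x
    by (rule has_density_on_interval(2)[OF F dens]) (use that in \<open>auto simp: S_def\<close>)
  obtain c R where cR: "c > 0" "R \<ge> exp 1"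
    "(\<integral>\<^sup>+x. ennreal (exp (c * \<bar>x\<bar> / ln \<bar>x\<bar>)) * indicator {x. \<bar>x\<bar> \<ge> R} x \<partial>F) < \<infinity>"
    by (rule exp_tail_of_density_ratio[OF F x0 assms(6-11)])
  obtain C r where cs: "carleman_sequence C r"
    and bd': "\<And>n. (\<integral>x. x ^ (2 * n) \<partial>F) \<le> (C * (\<Prod>k<n. r k))\<^sup>2"
    using moment_bound_of_exp_tail[OF F Ffin cR] by blast
  interpret cs: carleman_sequence C r by fact
  have bd: "(\<integral>x. x ^ (2 * n) \<partial>F) \<le> (cs.M n)\<^sup>2" for n using bd'[of n] by (simp add: cs.M_def)

  have moment_pos: "(\<integral>x. x ^ (2 * Suc n) \<partial>F) > 0" for n
  proof -
    have "2 * Suc n \<ge> 1" by simp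
    then have int: "integrable F (\<lambda>x. x ^ (2 * Suc n))" using Ffin unfolding finite_moments_def by blast
    have "0 < x\<^sub>0 ^ (2 * Suc n) * measure F {x\<^sub>0..x\<^sub>0 + 1}" using x0 pos by simp
    also have "\<dots> = (\<integral>x. x\<^sub>0 ^ (2 * Suc n) * indicator {x\<^sub>0..x\<^sub>0 + 1} x \<partial>F)" by simp
    also have "\<dots> \<le> (\<integral>x. x ^ (2 * Suc n) \<partial>F)"
    proof (rule Bochner_Integration.integral_mono[OF _ int])
      show "integrable F (\<lambda>x. x\<^sub>0 ^ (2 * Suc n) * indicator {x\<^sub>0..x\<^sub>0 + 1} x)"
        by (intro integrable_mult_right integrable_real_indicator) (auto simp: F.emeasure_eq_measure)
      fix x :: real
      have "0 \<le> x ^ (2 * Suc n)" by (rule zero_le_even_power) simp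
      moreover have "x\<^sub>0 ^ (2 * Suc n) \<le> x ^ (2 * Suc n)" if "x \<in> {x\<^sub>0..x\<^sub>0 + 1}"
        using that x0 by (intro power_mono) auto
      ultimately show "x\<^sub>0 ^ (2 * Suc n) * indicator {x\<^sub>0..x\<^sub>0 + 1} x \<le> x ^ (2 * Suc n)"
        by (cases "x \<in> {x\<^sub>0..x\<^sub>0 + 1}") (simp_all del: power_Suc mult_Suc_right)
    qed
    finally show ?thesis .
  qed
  have carleman: "(\<Sum>n. ennreal ((\<integral>\<omega>. X \<omega> ^ (2 * Suc n) \<partial>M) powr (- 1 / real (2 * Suc n)))) = \<infinity>"
    unfolding Fint[symmetric] by (rule cs.carleman_diverges[OF moment_pos bd])

  have det_X: "m_det_on UNIV (distr M borel X)"
    unfolding assms(3) by (rule cs.m_det_of_moment_bound[OF F Ffin bd])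

  have "distr M borel (\<lambda>\<omega>. (X \<omega>)\<^sup>2) = distr F borel (\<lambda>x. x\<^sup>2)"
    unfolding assms(3)[symmetric] by (subst distr_distr) (auto simp: comp_def)
  then have det_sq: "m_det_on UNIV (distr M borel (\<lambda>\<omega>. (X \<omega>)\<^sup>2))"
    using cs.m_det_square[OF F Ffin bd x0 _ pos nonatomic] by simp

  define N where "N = distr M borel (\<lambda>\<omega>. \<bar>X \<omega>\<bar>)"
  have N: "real_distribution N" unfolding N_def by (rule real_distribution_distr) simp
  have Nfin: "finite_moments N"
    unfolding finite_moments_def N_def
    using integrable_abs[OF assms(4)] by (auto simp: integrable_distr_eq power_abs)
  have "(\<integral>x. x ^ (2 * n) \<partial>N) = (\<integral>x. x ^ (2 * n) \<partial>F)" for n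
    unfolding N_def Fint by (subst integral_distr) (auto simp: power_mult)
  then have det_abs: "m_det_on UNIV N"
    using bd by (intro cs.m_det_of_moment_bound N Nfin) simp

  have half: "measure (distr M borel Y) {0..} = 1" if "Y \<in> borel_measurable M" "\<And>\<omega>. Y \<omega> \<ge> 0" for Y :: "'a \<Rightarrow> real"
  proof -
    have "Y -` {0..} \<inter> space M = space M" using that by auto
    then show ?thesis using that prob_space by (subst measure_distr) auto
  qed
  show ?thesis
    using carleman det_X det_sq det_abs m_det_on_half_lineI[OF det_sq half] m_det_on_half_lineI[OF det_abs[unfolded N_def] half]
    unfolding N_def by simp
qed

end
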